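(* Let $(B,m_B,u_B,\Delta_B,\varepsilon_B,c_B)$ be a $0$-connected graded braided bialgebra over a field $K$. Assume that - $m_B^{1,1}$ is an isomorphism; - $c_B^{1,1}$ has minimal polynomial $f(X)\in K[X]$, where - $f(-1)=0$, i.e. $f(X)=(X+1)h(X)$ for some $h\in K[X]$. Then $\mathrm{sdeg}(B)=\mathrm{sdeg}(S(B))+1$ and $m_{S(B)}^{1,1}\,h\big(c_{S(B)}^{1,1}\big)=0$.
   Context: $K$ is a field, vector spaces are over $K$, $\otimes=\otimes_K$, and the name of an object also denotes its identity map. A braided vector space $(V,c)$ is a vector space $V$ with a $K$-linear map $c:V\otimes V\to V\otimes V$ such that $(c\otimes V)(V\otimes c)(c\otimes V)=(V\otimes c)(c\otimes V)(V\otimes c)$. A braided algebra $(A,m,u,c)$ is an associative unital algebra with a braided vector space $(A,c)$ such that $c(m\otimes A)=(A\otimes m)(c\otimes A)(A\otimes c)$, $c(A\otimes m)=(m\otimes A)(A\otimes c)(c\otimes A)$, $c(u\otimes A)=A\otimes u$, $c(A\otimes u)=u\otimes A$; braided coalgebras are defined dually. A braided bialgebra is both a braided algebra and a braided coalgebra with $\Delta m=(m\otimes m)(B\otimes c\otimes B)(\Delta\otimes\Delta)$, with $\Delta,\varepsilon$ unital and $\varepsilon$ multiplicative. It is graded if $B=\bigoplus_{n\in\mathbb N}B^n$ with $m,\Delta$ graded, $c(B^a\otimes B^b)\subseteq B^b\otimes B^a$ and $\varepsilon|_{B^n}=0$ for $n>0$; $m_B^{a,b}:B^a\otimes B^b\to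 B^{a+b}$, $\Delta_B^{a,b}:B^{a+b}\to B^a\otimes B^b$, $c_B^{a,b}:B^a\otimes B^b\to B^b\otimes B^a$ denote homogeneous components. $B$ is $0$-connected if $B^0$ is one-dimensional. Put $E_n(B)=\bigcap_{a,b\ge1,\ a+b=n}\ker(\Delta_B^{a,b})$ for $n\ge2$, $E(B)=\bigoplus_{n\ge2}E_n(B)$; the symmetric algebra $S(B)=B/(E(B))$ (quotient by the generated two-sided ideal) is again a graded braided bialgebra via the projection. Put $S^{[0]}(B)=B$, $S^{[n]}(B)=S(S^{[n-1]}(B))$. The strongness degree $\mathrm{sdeg}(B)$ is the least $t\in\mathbb N$ such that the projection $S^{[t]}(B)\to S^{[t+1]}(B)$ is an isomorphism, and $\infty$ if none exists (with $\infty+1=\infty$). *)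

theory Defs
  imports
    "HOL-Computational_Algebra.Polynomial"
    "HOL-Library.Function_Algebras"
    "HOL-Library.Extended_Nat"
begin

section \<open>Vector spaces with carriers\<close>

text \<open>
  The ground field is a type \<^typ>\<open>'k\<close> of class \<^class>\<open>field\<close>. A vector space is a subspace
  \<open>car V\<close> of a type equipped with a scalar multiplication \<open>scl V\<close>; a carrier is needed
  because quotients have to stay inside one type in order to be iterated.
\<close>

record ('k, 'a) vspace =
  scl :: "'k \<Rightarrow> 'a \<Rightarrow> 'a"
  car :: "'a set"

definition is_vspace :: "('k::field, 'a::ab_group_add, 'm) vspace_scheme \<Rightarrow> bool" where
  "is_vspace V \<longleftrightarrow> vector_space (scl V) \<and> module.subspace (scl V) (car V)"

definition lin :: "('k::field, 'a::ab_group_add, 'm) vspace_scheme \<Rightarrow>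
    ('k, 'b::ab_group_add, 'n) vspace_scheme \<Rightarrow> ('a \<Rightarrow> 'b) \<Rightarrow> bool" where
  "lin V W f \<longleftrightarrow> (\<forall>x\<in>car V. f x \<in> car W)
     \<and> (\<forall>x\<in>car V. \<forall>y\<in>car V. f (x + y) = f x + f y)
     \<and> (\<forall>k. \<forall>x\<in>car V. f (scl V k x) = scl W k (f x))"

definition bilin :: "('k::field, 'a::ab_group_add, 'm) vspace_scheme \<Rightarrow>
    ('k, 'b::ab_group_add, 'n) vspace_scheme \<Rightarrow>
    ('k, 'c::ab_group_add, 'p) vspace_scheme \<Rightarrow> ('a \<Rightarrow> 'b \<Rightarrow> 'c) \<Rightarrow> bool" where
  "bilin V W U \<phi> \<longleftrightarrow> (\<forall>x\<in>car V. lin W U (\<phi> x)) \<and> (\<forall>y\<in>car W. lin V U (\<lambda>x. \<phi> x y))"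

definition ground :: "('k::field, 'k) vspace" where
  "ground = \<lparr>scl = (*), car = UNIV\<rparr>"


section \<open>Tensor products\<close>

text \<open>
  Over a field, \<open>V \<otimes> W\<close> embeds into the dual of the space of bilinear forms on
  \<open>V \<times> W\<close>: the pure tensor of \<open>x\<close> and \<open>y\<close> is evaluation of forms at \<open>(x, y)\<close>, and
  \<open>V \<otimes> W\<close> is the span of the pure tensors. The universal property is proved below
  (\<open>tensor_universal\<close>). Pure tensors vanish on arguments that are not bilinear forms, so that
  equality of tensors is equality of functions.
\<close>

type_synonym ('k, 'a, 'b) tensor = "('a \<Rightarrow> 'b \<Rightarrow> 'k) \<Rightarrow> 'k"

definition ptensor :: "('k::field, 'a::ab_group_add, 'm) vspace_scheme \<Rightarrow>
    ('k, 'b::ab_group_add, 'n) vspace_scheme \<Rightarrow> 'a \<Rightarrow> 'b \<Rightarrow> ('k, 'a, 'b) tensor" where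
  "ptensor V W x y = (\<lambda>\<beta>. if bilin V W ground \<beta> then \<beta> x y else 0)"

definition tscl :: "'k::field \<Rightarrow> ('k, 'a, 'b) tensor \<Rightarrow> ('k, 'a, 'b) tensor" where
  "tscl k t = (\<lambda>\<beta>. k * t \<beta>)"

definition subtensor :: "('k::field, 'a::ab_group_add, 'm) vspace_scheme \<Rightarrow>
    ('k, 'b::ab_group_add, 'n) vspace_scheme \<Rightarrow> 'a set \<Rightarrow> 'b set \<Rightarrow> ('k, 'a, 'b) tensor set" where
  "subtensor V W A C = module.span tscl {ptensor V W x y | x y. x \<in> A \<and> y \<in> C}"

definition tprod :: "('k::field, 'a::ab_group_add, 'm) vspace_scheme \<Rightarrow>
    ('k, 'b::ab_group_add, 'n) vspace_scheme \<Rightarrow> ('k, ('k, 'a, 'b) tensor) vspace"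
    (infixl \<open>\<otimes>\<close> 70) where
  "V \<otimes> W = \<lparr>scl = tscl, car = subtensor V W (car V) (car W)\<rparr>"

text \<open>
  The next three maps are characterised by \<open>tmap_ptensor\<close>, \<open>tassoc_ptensor\<close> and \<open>tassoc_inv_ptensor\<close>
  below. The spaces given to \<open>tmap\<close> are the codomains of \<open>f\<close> and \<open>g\<close>.
\<close>

definition tmap :: "('k::field, 'c::ab_group_add, 'm) vspace_scheme \<Rightarrow>
    ('k, 'd::ab_group_add, 'n) vspace_scheme \<Rightarrow> ('a \<Rightarrow> 'c) \<Rightarrow> ('b \<Rightarrow> 'd) \<Rightarrow>
    ('k, 'a, 'b) tensor \<Rightarrow> ('k, 'c, 'd) tensor" where
  "tmap V' W' f g t = (\<lambda>\<beta>. if bilin V' W' ground \<beta> then t (\<lambda>x y. \<beta> (f x) (g y)) else 0)"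

definition tassoc :: "('k::field, 'a::ab_group_add, 'm) vspace_scheme \<Rightarrow>
    ('k, 'b::ab_group_add, 'n) vspace_scheme \<Rightarrow> ('k, 'c::ab_group_add, 'p) vspace_scheme \<Rightarrow>
    ('k, ('k, 'a, 'b) tensor, 'c) tensor \<Rightarrow> ('k, 'a, ('k, 'b, 'c) tensor) tensor" where
  "tassoc U V W t = (\<lambda>\<beta>. if bilin U (V \<otimes> W) ground \<beta>
     then t (\<lambda>s z. s (\<lambda>x y. \<beta> x (ptensor V W y z))) else 0)"

definition tassoc_inv :: "('k::field, 'a::ab_group_add, 'm) vspace_scheme \<Rightarrow>
    ('k, 'b::ab_group_add, 'n) vspace_scheme \<Rightarrow> ('k, 'c::ab_group_add, 'p) vspace_scheme \<Rightarrow>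
    ('k, 'a, ('k, 'b, 'c) tensor) tensor \<Rightarrow> ('k, ('k, 'a, 'b) tensor, 'c) tensor" where
  "tassoc_inv U V W t = (\<lambda>\<beta>. if bilin (U \<otimes> V) W ground \<beta>
     then t (\<lambda>x s. s (\<lambda>y z. \<beta> (ptensor U V x y) z)) else 0)"


section \<open>Graded braided bialgebras\<close>

record ('k, 'a) bialg = "('k, 'a) vspace" +
  mult :: "('k, 'a, 'a) tensor \<Rightarrow> 'a"
  unit_map :: "'k \<Rightarrow> 'a"
  comult :: "'a \<Rightarrow> ('k, 'a, 'a) tensor"
  counit :: "'a \<Rightarrow> 'k"
  braid :: "('k, 'a, 'a) tensor \<Rightarrow> ('k, 'a, 'a) tensor"
  hcomp :: "nat \<Rightarrow> 'a set"

text \<open>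
  \<open>braid_l\<close> and \<open>braid_r\<close> are \<open>c \<otimes> V\<close> and \<open>V \<otimes> c\<close>, both on \<open>(V \<otimes> V) \<otimes> V\<close>, and
  \<open>braid_mid\<close> is \<open>V \<otimes> c \<otimes> V\<close> on \<open>(V \<otimes> V) \<otimes> (V \<otimes> V)\<close>.
\<close>

definition braid_l :: "('k::field, 'a::ab_group_add) bialg \<Rightarrow>
    ('k, ('k, 'a, 'a) tensor, 'a) tensor \<Rightarrow> ('k, ('k, 'a, 'a) tensor, 'a) tensor" where
  "braid_l V = tmap (V \<otimes> V) V (braid V) id"

definition braid_r :: "('k::field, 'a::ab_group_add) bialg \<Rightarrow>
    ('k, ('k, 'a, 'a) tensor, 'a) tensor \<Rightarrow> ('k, ('k, 'a, 'a) tensor, 'a) tensor" where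
  "braid_r V = tassoc_inv V V V \<circ> tmap V (V \<otimes> V) id (braid V) \<circ> tassoc V V V"

definition braid_mid :: "('k::field, 'a::ab_group_add) bialg \<Rightarrow>
    ('k, ('k, 'a, 'a) tensor, ('k, 'a, 'a) tensor) tensor \<Rightarrow>
    ('k, ('k, 'a, 'a) tensor, ('k, 'a, 'a) tensor) tensor" where
  "braid_mid V = tassoc_inv V V (V \<otimes> V)
     \<circ> tmap V (V \<otimes> (V \<otimes> V)) id (tassoc V V V \<circ> braid_l V \<circ> tassoc_inv V V V)
     \<circ> tassoc V V (V \<otimes> V)"

definition braided_vspace :: "('k::field, 'a::ab_group_add) bialg \<Rightarrow> bool" where
  "braided_vspace V \<longleftrightarrow> is_vspace V \<and> lin (V \<otimes> V) (V \<otimes> V) (braid V)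
     \<and> (\<forall>t\<in>car (V \<otimes> V \<otimes> V).
          braid_l V (braid_r V (braid_l V t)) = braid_r V (braid_l V (braid_r V t)))"

text \<open>
  Axioms involving the canonical isomorphisms \<open>K \<otimes> A \<cong> A \<cong> A \<otimes> K\<close> are written out on
  elements: \<open>c (u \<otimes> A) = A \<otimes> u\<close>, for instance, says \<open>c (u k \<otimes> x) = x \<otimes> u k\<close>.
\<close>

definition braided_algebra :: "('k::field, 'a::ab_group_add) bialg \<Rightarrow> bool" where
  "braided_algebra A \<longleftrightarrow> braided_vspace A
     \<and> lin (A \<otimes> A) A (mult A) \<and> lin ground A (unit_map A)
     \<and> (\<forall>t\<in>car (A \<otimes> A \<otimes> A).
          mult A (tmap A A (mult A) id t) = mult A (tmap A A id (mult A) (tassoc A A A t)))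
     \<and> (\<forall>k. \<forall>x\<in>car A. mult A (ptensor A A (unit_map A k) x) = scl A k x
          \<and> mult A (ptensor A A x (unit_map A k)) = scl A k x)
     \<and> (\<forall>t\<in>car (A \<otimes> A \<otimes> A).
          braid A (tmap A A (mult A) id t)
            = tmap A A id (mult A) (tassoc A A A (braid_l A (braid_r A t))))
     \<and> (\<forall>t\<in>car (A \<otimes> A \<otimes> A).
          braid A (tmap A A id (mult A) (tassoc A A A t))
            = tmap A A (mult A) id (braid_r A (braid_l A t)))
     \<and> (\<forall>k. \<forall>x\<in>car A. braid A (ptensor A A (unit_map A k) x) = ptensor A A x (unit_map A k)
          \<and> braid A (ptensor A A x (unit_map A k)) = ptensor A A (unit_map A k) x)"

text \<open>
  Reversing all arrows, the compatibilities with \<open>c\<close> become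
  \<open>(\<Delta> \<otimes> C) c = (C \<otimes> c) (c \<otimes> C) (C \<otimes> \<Delta>)\<close>, \<open>(C \<otimes> \<Delta>) c = (c \<otimes> C) (C \<otimes> c) (\<Delta> \<otimes> C)\<close>,
  \<open>(\<epsilon> \<otimes> C) c = C \<otimes> \<epsilon>\<close> and \<open>(C \<otimes> \<epsilon>) c = \<epsilon> \<otimes> C\<close>.
\<close>

definition braided_coalgebra :: "('k::field, 'a::ab_group_add) bialg \<Rightarrow> bool" where
  "braided_coalgebra C \<longleftrightarrow> braided_vspace C
     \<and> lin C (C \<otimes> C) (comult C) \<and> lin C ground (counit C)
     \<and> (\<forall>x\<in>car C. tassoc C C C (tmap (C \<otimes> C) C (comult C) id (comult C x))
          = tmap C (C \<otimes> C) id (comult C) (comult C x))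
     \<and> (\<forall>x\<in>car C. tmap ground C (counit C) id (comult C x) = ptensor ground C 1 x
          \<and> tmap C ground id (counit C) (comult C x) = ptensor C ground x 1)
     \<and> (\<forall>t\<in>car (C \<otimes> C).
          tmap (C \<otimes> C) C (comult C) id (braid C t)
            = braid_r C (braid_l C (tassoc_inv C C C (tmap C (C \<otimes> C) id (comult C) t))))
     \<and> (\<forall>t\<in>car (C \<otimes> C).
          tmap C (C \<otimes> C) id (comult C) (braid C t)
            = tassoc C C C (braid_l C (braid_r C (tmap (C \<otimes> C) C (comult C) id t))))
     \<and> (\<forall>x\<in>car C. \<forall>y\<in>car C.
          tmap ground C (counit C) id (braid C (ptensor C C x y)) = ptensor ground C (counit C y) x
          \<and> tmap C ground id (counit C) (braid C (ptensor C C x y)) = ptensor C ground y (counit C x))"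

definition braided_bialgebra :: "('k::field, 'a::ab_group_add) bialg \<Rightarrow> bool" where
  "braided_bialgebra B \<longleftrightarrow> braided_algebra B \<and> braided_coalgebra B
     \<and> (\<forall>t\<in>car (B \<otimes> B). comult B (mult B t)
          = tmap B B (mult B) (mult B)
              (braid_mid B (tmap (B \<otimes> B) (B \<otimes> B) (comult B) (comult B) t)))
     \<and> comult B (unit_map B 1) = ptensor B B (unit_map B 1) (unit_map B 1)
     \<and> counit B (unit_map B 1) = 1
     \<and> (\<forall>x\<in>car B. \<forall>y\<in>car B. counit B (mult B (ptensor B B x y)) = counit B x * counit B y)"

definition homogeneous_parts :: "(nat \<Rightarrow> 'a::ab_group_add set) \<Rightarrow> 'a \<Rightarrow> (nat \<Rightarrow> 'a) \<Rightarrow> bool" where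
  "homogeneous_parts G x f \<longleftrightarrow>
     (\<forall>n. f n \<in> G n) \<and> finite {n. f n \<noteq> 0} \<and> x = (\<Sum>n | f n \<noteq> 0. f n)"

definition direct_sum :: "('k::field, 'a::ab_group_add, 'm) vspace_scheme \<Rightarrow> (nat \<Rightarrow> 'a set) \<Rightarrow> bool" where
  "direct_sum V G \<longleftrightarrow> (\<forall>n. module.subspace (scl V) (G n) \<and> G n \<subseteq> car V)
     \<and> (\<forall>x\<in>car V. \<exists>!f. homogeneous_parts G x f)"

text \<open>
  \<open>B\<^sup>a \<otimes> B\<^sup>b\<close> as a subspace of \<open>B \<otimes> B\<close>. Since \<open>m\<close> and \<open>c\<close> are graded, their homogeneous
  components are just their restrictions to these subspaces.
\<close>

definition hcomp2 :: "('k::field, 'a::ab_group_add) bialg \<Rightarrow> nat \<Rightarrow> nat \<Rightarrow> ('k, 'a, 'a) tensor set" where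
  "hcomp2 B a b = subtensor B B (hcomp B a) (hcomp B b)"

definition graded_braided_bialgebra :: "('k::field, 'a::ab_group_add) bialg \<Rightarrow> bool" where
  "graded_braided_bialgebra B \<longleftrightarrow> braided_bialgebra B \<and> direct_sum B (hcomp B)
     \<and> (\<forall>a b. mult B ` hcomp2 B a b \<subseteq> hcomp B (a + b))
     \<and> (\<forall>n. comult B ` hcomp B n \<subseteq> module.span tscl (\<Union>{hcomp2 B a b | a b. a + b = n}))
     \<and> (\<forall>a b. braid B ` hcomp2 B a b \<subseteq> hcomp2 B b a)
     \<and> (\<forall>n>0. \<forall>x\<in>hcomp B n. counit B x = 0)"

definition zero_connected :: "('k::field, 'a::ab_group_add) bialg \<Rightarrow> bool" where
  "zero_connected B \<longleftrightarrow> vector_space.dim (scl B) (hcomp B 0) = 1"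


section \<open>The symmetric algebra and the strongness degree\<close>

definition hpart :: "('k::field, 'a::ab_group_add) bialg \<Rightarrow> nat \<Rightarrow> 'a \<Rightarrow> 'a" where
  "hpart B n x = (THE f. homogeneous_parts (hcomp B) x f) n"

definition comult_comp :: "('k::field, 'a::ab_group_add) bialg \<Rightarrow> nat \<Rightarrow> nat \<Rightarrow>
    'a \<Rightarrow> ('k, 'a, 'a) tensor" where
  "comult_comp B a b x = tmap B B (hpart B a) (hpart B b) (comult B x)"

definition E_comp :: "('k::field, 'a::ab_group_add) bialg \<Rightarrow> nat \<Rightarrow> 'a set" where
  "E_comp B n = {x \<in> hcomp B n. \<forall>a b. 1 \<le> a \<and> 1 \<le> b \<and> a + b = n \<longrightarrow> comult_comp B a b x = 0}"

definition E_space :: "('k::field, 'a::ab_group_add) bialg \<Rightarrow> 'a set" where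
  "E_space B = module.span (scl B) (\<Union>n\<in>{2..}. E_comp B n)"

definition two_sided_ideal :: "('k::field, 'a::ab_group_add) bialg \<Rightarrow> 'a set \<Rightarrow> bool" where
  "two_sided_ideal B I \<longleftrightarrow> module.subspace (scl B) I \<and> I \<subseteq> car B
     \<and> (\<forall>x\<in>car B. \<forall>y\<in>I. mult B (ptensor B B x y) \<in> I \<and> mult B (ptensor B B y x) \<in> I)"

definition ideal_gen :: "('k::field, 'a::ab_group_add) bialg \<Rightarrow> 'a set \<Rightarrow> 'a set" where
  "ideal_gen B X = \<Inter>{I. two_sided_ideal B I \<and> X \<subseteq> I}"

text \<open>
  The quotient space \<open>V/I\<close> is realised inside \<open>V\<close>, on a complement of \<open>I\<close>: the quotient map
  is a linear map \<open>p\<close> with kernel \<open>I\<close>, chosen idempotent so that its image is a set of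
  representatives. Such a \<open>p\<close> always exists (\<open>quot_map_exists\<close> below).
\<close>

definition is_quot_map :: "('k::field, 'a::ab_group_add, 'm) vspace_scheme \<Rightarrow> 'a set \<Rightarrow> ('a \<Rightarrow> 'a) \<Rightarrow> bool" where
  "is_quot_map V I p \<longleftrightarrow> lin V V p \<and> (\<forall>x\<in>car V. p (p x) = p x) \<and> {x \<in> car V. p x = 0} = I"

definition quot_map :: "('k::field, 'a::ab_group_add, 'm) vspace_scheme \<Rightarrow> 'a set \<Rightarrow> 'a \<Rightarrow> 'a" where
  "quot_map V I = (SOME p. is_quot_map V I p)"

definition sym_proj :: "('k::field, 'a::ab_group_add) bialg \<Rightarrow> 'a \<Rightarrow> 'a" where
  "sym_proj B = quot_map B (ideal_gen B (E_space B))"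

text \<open>
  \<open>S(B) = B/(E(B))\<close> with the structure induced along the projection \<open>p\<close>. The inclusion of the
  complement is a linear section of \<open>p\<close>, so every induced map is obtained by lifting arguments
  along the inclusion (\<^term>\<open>tmap B B id id\<close> on tensors) and projecting the result.
\<close>

definition sym_alg :: "('k::field, 'a::ab_group_add) bialg \<Rightarrow> ('k, 'a) bialg" where
  "sym_alg B =
     (let p = sym_proj B;
          Q = \<lparr>scl = scl B, car = p ` car B\<rparr>
      in \<lparr>scl = scl B, car = p ` car B,
          mult = p \<circ> mult B \<circ> tmap B B id id,
          unit_map = p \<circ> unit_map B,
          comult = tmap Q Q p p \<circ> comult B,
          counit = counit B,
          braid = tmap Q Q p p \<circ> braid B \<circ> tmap B B id id,
          hcomp = (\<lambda>n. p ` hcomp B n)\<rparr>)"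

definition sym_iter :: "nat \<Rightarrow> ('k::field, 'a::ab_group_add) bialg \<Rightarrow> ('k, 'a) bialg" where
  "sym_iter n B = (sym_alg ^^ n) B"

text \<open>
  The projection is a morphism of graded braided bialgebras by construction of the quotient, so
  it is an isomorphism iff it is bijective.
\<close>

definition sym_stable :: "('k::field, 'a::ab_group_add) bialg \<Rightarrow> nat \<Rightarrow> bool" where
  "sym_stable B t \<longleftrightarrow>
     bij_betw (sym_proj (sym_iter t B)) (car (sym_iter t B)) (car (sym_iter (Suc t) B))"

definition sdeg :: "('k::field, 'a::ab_group_add) bialg \<Rightarrow> enat" where
  "sdeg B = (if \<exists>t. sym_stable B t then enat (LEAST t. sym_stable B t) else \<infinity>)"


section \<open>Polynomials of an endomorphism\<close>

definition poly_endo :: "('k \<Rightarrow> 'a \<Rightarrow> 'a) \<Rightarrow> 'k::field poly \<Rightarrow> ('a \<Rightarrow> 'a) \<Rightarrow> 'a::ab_group_add \<Rightarrow> 'a" where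
  "poly_endo s g T x = (\<Sum>i\<le>degree g. s (coeff g i) ((T ^^ i) x))"

definition annihilates :: "('k \<Rightarrow> 'a \<Rightarrow> 'a) \<Rightarrow> 'a::ab_group_add set \<Rightarrow> ('a \<Rightarrow> 'a) \<Rightarrow> 'k::field poly \<Rightarrow> bool" where
  "annihilates s X T g \<longleftrightarrow> (\<forall>x\<in>X. poly_endo s g T x = 0)"

definition is_min_poly :: "('k \<Rightarrow> 'a \<Rightarrow> 'a) \<Rightarrow> 'a::ab_group_add set \<Rightarrow> ('a \<Rightarrow> 'a) \<Rightarrow> 'k::field poly \<Rightarrow> bool" where
  "is_min_poly s X T f \<longleftrightarrow> lead_coeff f = 1 \<and> annihilates s X T f
     \<and> (\<forall>g. g \<noteq> 0 \<and> annihilates s X T g \<longrightarrow> degree f \<le> degree g)"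


section \<open>Adequacy of the encodings\<close>

lemma vector_space_ground: "vector_space ((*) :: 'k::field \<Rightarrow> 'k \<Rightarrow> 'k)"
  by unfold_locales (auto simp: algebra_simps)

lemma vector_space_tscl: "vector_space (tscl :: 'k::field \<Rightarrow> ('k, 'a, 'b) tensor \<Rightarrow> _)"
  by unfold_locales (auto simp: tscl_def fun_eq_iff algebra_simps)

interpretation tensor: vector_space tscl
  by (rule vector_space_tscl)

lemma is_vspace_tprod: "is_vspace (V \<otimes> W)"
  by (simp add: is_vspace_def tprod_def subtensor_def vector_space_tscl tensor.subspace_span)

lemma ptensor_in: "x \<in> car V \<Longrightarrow> y \<in> car W \<Longrightarrow> ptensor V W x y \<in> car (V \<otimes> W)"
  by (auto simp: tprod_def subtensor_def intro!: tensor.span_base)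

lemma tmap_ptensor:
  assumes "lin V V' f" "lin W W' g" "x \<in> car V" "y \<in> car W"
  shows "tmap V' W' f g (ptensor V W x y) = ptensor V' W' (f x) (g y)"
proof -
  have "bilin V W ground (\<lambda>x y. \<beta> (f x) (g y))" if "bilin V' W' ground \<beta>" for \<beta>
    using that assms(1,2) unfolding bilin_def lin_def by (simp add: ground_def)
  then show ?thesis
    by (auto simp: tmap_def ptensor_def fun_eq_iff)
qed

lemma bilin_ptensor: "bilin V W (V \<otimes> W) (ptensor V W)"
  unfolding bilin_def lin_def
  by (auto simp: ptensor_in)
     (auto simp: ptensor_def tprod_def tscl_def fun_eq_iff bilin_def lin_def ground_def)

lemma tensor_induct [consumes 1, case_names zero add]:
  assumes t: "t \<in> car (V \<otimes> W)" and P0: "P 0"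
    and Pa: "\<And>k x y t. x \<in> car V \<Longrightarrow> y \<in> car W \<Longrightarrow> t \<in> car (V \<otimes> W) \<Longrightarrow> P t \<Longrightarrow>
      P (tscl k (ptensor V W x y) + t)"
  shows "P t"
proof -
  let ?S = "{ptensor V W x y |x y. x \<in> car V \<and> y \<in> car W}"
  have car: "car (V \<otimes> W) = tensor.span ?S"
    by (simp add: tprod_def subtensor_def)
  have "t \<in> tensor.span ?S"
    using t car by blast
  then have "t \<in> tensor.span ?S \<and> P t"
  proof (induction rule: tensor.span_induct_alt)
    case base
    show ?case using P0 tensor.span_zero by blast
  next
    case (step c u v)
    then obtain x y where u: "u = ptensor V W x y" "x \<in> car V" "y \<in> car W" by blast
    then have "P (tscl c u + v)"
      using step Pa[of x y v c] car by blast
    moreover have "tscl c u + v \<in> tensor.span ?S"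
      using step by (blast intro: tensor.span_add tensor.span_scale tensor.span_base)
    ultimately show ?case by blast
  qed
  then show ?thesis ..
qed

lemma vspace_closed:
  assumes "is_vspace V"
  shows "x \<in> car V \<Longrightarrow> y \<in> car V \<Longrightarrow> x + y \<in> car V" and "x \<in> car V \<Longrightarrow> scl V k x \<in> car V"
proof -
  interpret V: vector_space "scl V" using assms by (simp add: is_vspace_def)
  have "V.subspace (car V)" using assms by (simp add: is_vspace_def)
  then show "x \<in> car V \<Longrightarrow> y \<in> car V \<Longrightarrow> x + y \<in> car V" and "x \<in> car V \<Longrightarrow> scl V k x \<in> car V"
    by (auto simp: V.subspace_add V.subspace_scale)
qed

lemma bilin_compose:
  assumes "bilin V W U \<phi>" "lin U X l"
  shows "bilin V W X (\<lambda>x y. l (\<phi> x y))"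
  using assms unfolding bilin_def lin_def by simp

lemma tassoc_ptensor:
  assumes W: "is_vspace W" and xyz: "x \<in> car U" "y \<in> car V" "z \<in> car W"
  shows "tassoc U V W (ptensor (U \<otimes> V) W (ptensor U V x y) z)
       = ptensor U (V \<otimes> W) x (ptensor V W y z)"
proof
  fix \<beta>
  show "tassoc U V W (ptensor (U \<otimes> V) W (ptensor U V x y) z) \<beta>
      = ptensor U (V \<otimes> W) x (ptensor V W y z) \<beta>"
  proof (cases "bilin U (V \<otimes> W) ground \<beta>")
    case True
    have p: "bilin V W (V \<otimes> W) (ptensor V W)" by (rule bilin_ptensor)
    have 1: "bilin U V ground (\<lambda>x y. \<beta> x (ptensor V W y z))" if "z \<in> car W" for z
      using True p that unfolding bilin_def lin_def by simp
    have 2: "lin W ground (\<lambda>z. s (\<lambda>x y. \<beta> x (ptensor V W y z)))" if "s \<in> car (U \<otimes> V)" for s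
      using that
    proof (induction rule: tensor_induct)
      case zero
      show ?case by (simp add: lin_def ground_def)
    next
      case (add k x y t)
      have "lin W ground (\<lambda>z. \<beta> x (ptensor V W y z))"
        using True p add unfolding bilin_def lin_def by simp
      moreover have "(tscl k (ptensor U V x y) + t) (\<lambda>x y. \<beta> x (ptensor V W y z))
          = k * \<beta> x (ptensor V W y z) + t (\<lambda>x y. \<beta> x (ptensor V W y z))" if "z \<in> car W" for z
        using 1[OF that] by (simp add: tscl_def ptensor_def[of U V])
      ultimately show ?case
        using add.IH vspace_closed[OF W] unfolding lin_def by (simp add: ground_def algebra_simps)
    qed
    have "bilin (U \<otimes> V) W ground (\<lambda>s z. s (\<lambda>x y. \<beta> x (ptensor V W y z)))"
      unfolding bilin_def
      using 2 by (simp add: lin_def tprod_def tscl_def ground_def)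
    with True 1[OF xyz(3)] show ?thesis
      unfolding tassoc_def ptensor_def[of "U \<otimes> V"] ptensor_def[of U] by simp
  next
    case False
    then show ?thesis by (simp add: tassoc_def ptensor_def)
  qed
qed

lemma tassoc_inv_ptensor:
  assumes U: "is_vspace U" and xyz: "x \<in> car U" "y \<in> car V" "z \<in> car W"
  shows "tassoc_inv U V W (ptensor U (V \<otimes> W) x (ptensor V W y z))
       = ptensor (U \<otimes> V) W (ptensor U V x y) z"
proof
  fix \<beta>
  show "tassoc_inv U V W (ptensor U (V \<otimes> W) x (ptensor V W y z)) \<beta>
      = ptensor (U \<otimes> V) W (ptensor U V x y) z \<beta>"
  proof (cases "bilin (U \<otimes> V) W ground \<beta>")
    case True
    have p: "bilin U V (U \<otimes> V) (ptensor U V)" by (rule bilin_ptensor)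
    have 1: "bilin V W ground (\<lambda>y z. \<beta> (ptensor U V x y) z)" if "x \<in> car U" for x
      using True p that unfolding bilin_def lin_def by simp
    have 2: "lin U ground (\<lambda>x. s (\<lambda>y z. \<beta> (ptensor U V x y) z))" if "s \<in> car (V \<otimes> W)" for s
      using that
    proof (induction rule: tensor_induct)
      case zero
      show ?case by (simp add: lin_def ground_def)
    next
      case (add k y z t)
      have "lin U ground (\<lambda>x. \<beta> (ptensor U V x y) z)"
        using True p add unfolding bilin_def lin_def by simp
      moreover have "(tscl k (ptensor V W y z) + t) (\<lambda>y z. \<beta> (ptensor U V x y) z)
          = k * \<beta> (ptensor U V x y) z + t (\<lambda>y z. \<beta> (ptensor U V x y) z)" if "x \<in> car U" for x
        using 1[OF that] by (simp add: tscl_def ptensor_def[of V W])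
      ultimately show ?case
        using add.IH vspace_closed[OF U] unfolding lin_def by (simp add: ground_def algebra_simps)
    qed
    have "bilin U (V \<otimes> W) ground (\<lambda>x s. s (\<lambda>y z. \<beta> (ptensor U V x y) z))"
      unfolding bilin_def
      using 2 by (simp add: lin_def tprod_def tscl_def ground_def)
    with True 1[OF xyz(1)] show ?thesis
      unfolding tassoc_inv_def ptensor_def[of U "V \<otimes> W"] ptensor_def[of V] ptensor_def[of "U \<otimes> V"] by simp
  next
    case False
    then show ?thesis by (simp add: tassoc_inv_def ptensor_def)
  qed
qed

lemma functionals_separate:
  fixes U :: "('k::field, 'c::ab_group_add, 'm) vspace_scheme"
  assumes "is_vspace U" "u \<noteq> 0"
  shows "\<exists>l. lin U ground l \<and> l u \<noteq> 0"
proof -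
  interpret U: vector_space "scl U" using assms(1) by (simp add: is_vspace_def)
  interpret UK: vector_space_pair "scl U" "(*) :: 'k \<Rightarrow> 'k \<Rightarrow> 'k"
    by (intro vector_space_pair.intro U.vector_space_axioms vector_space_ground)
  have "U.independent {u}" using assms(2) by simp
  from UK.linear_independent_extend[OF this, of "\<lambda>_. 1"]
  obtain g where g: "Vector_Spaces.linear (scl U) (*) g" "g u = 1" by auto
  interpret g: Vector_Spaces.linear "scl U" "(*)" g by (fact g(1))
  have "lin U ground g" by (simp add: lin_def ground_def g.add g.scale)
  with g(2) show ?thesis by (intro exI[of _ g]) simp
qed

theorem tensor_universal:
  fixes U :: "('k::field, 'c::ab_group_add, 'm) vspace_scheme"
  assumes U: "is_vspace U" and phi: "bilin V W U \<phi>"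
  shows "\<exists>h. lin (V \<otimes> W) U h \<and> (\<forall>x\<in>car V. \<forall>y\<in>car W. h (ptensor V W x y) = \<phi> x y)
    \<and> (\<forall>h'. lin (V \<otimes> W) U h' \<and> (\<forall>x\<in>car V. \<forall>y\<in>car W. h' (ptensor V W x y) = \<phi> x y)
          \<longrightarrow> (\<forall>t\<in>car (V \<otimes> W). h' t = h t))"
proof -
  interpret U: vector_space "scl U" using U by (simp add: is_vspace_def)
  have sub: "U.subspace (car U)" using U by (simp add: is_vspace_def)
  define R where "R t u \<longleftrightarrow> u \<in> car U \<and> (\<forall>l. lin U ground l \<longrightarrow> l u = t (\<lambda>x y. l (\<phi> x y)))" for t u
  have unique: "u = v" if "R t u" "R t v" for t u v
  proof (rule ccontr)
    assume "u \<noteq> v"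
    then obtain l where l: "lin U ground l" "l (u - v) \<noteq> 0"
      using functionals_separate[OF U, of "u - v"] by auto
    have "l ((u - v) + v) = l (u - v) + l v"
      using l(1) that sub unfolding lin_def R_def by (meson U.subspace_diff)
    moreover have "l u = l v" using that l(1) unfolding R_def by metis
    ultimately show False using l(2) by simp
  qed
  have R0: "R 0 0"
  proof -
    have "l 0 = 0" if "lin U ground l" for l
    proof -
      have "l (0 + 0) = l 0 + l 0"
        using that U.subspace_0[OF sub] unfolding lin_def by blast
      then show ?thesis by (metis add.right_neutral add_left_cancel)
    qed
    then show ?thesis using U.subspace_0[OF sub] by (simp add: R_def)
  qed
  have Radd: "R (s + t) (u + v)" if "R s u" "R t v" for s t u v
    using that U.subspace_add[OF sub] unfolding R_def lin_def by simp
  have Rscale: "R (tscl k t) (scl U k u)" if "R t u" for k t u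
    using that U.subspace_scale[OF sub] unfolding R_def lin_def by (simp add: tscl_def ground_def)
  have Rpure: "R (ptensor V W x y) (\<phi> x y)" if "x \<in> car V" "y \<in> car W" for x y
    using that phi bilin_compose[OF phi]
    by (auto simp: R_def ptensor_def) (simp add: bilin_def lin_def)
  have ex: "\<exists>u. R t u" if "t \<in> car (V \<otimes> W)" for t
    using that
  proof (induction rule: tensor_induct)
    case zero
    show ?case using R0 by blast
  next
    case (add k x y t)
    then show ?case using Radd Rscale Rpure by blast
  qed
  define h where "h t = (THE u. R t u)" for t
  have h: "h t = u" if "R t u" for t u
    unfolding h_def using that unique by blast
  have hR: "R t (h t)" if "t \<in> car (V \<otimes> W)" for t
    using ex[OF that] h by auto
  have "lin (V \<otimes> W) U h"
    unfolding lin_def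
  proof (intro conjI ballI allI)
    fix s assume s: "s \<in> car (V \<otimes> W)"
    show "h s \<in> car U" using hR[OF s] by (simp add: R_def)
    show "h (s + t) = h s + h t" if "t \<in> car (V \<otimes> W)" for t
      using hR s that Radd h by blast
    show "h (scl (V \<otimes> W) k s) = scl U k (h s)" for k
      using h[OF Rscale[OF hR[OF s]]] by (simp add: tprod_def)
  qed
  moreover have "h' t = h t"
    if "lin (V \<otimes> W) U h'" "\<And>x y. x \<in> car V \<Longrightarrow> y \<in> car W \<Longrightarrow> h' (ptensor V W x y) = \<phi> x y"
      "t \<in> car (V \<otimes> W)" for h' t
  proof -
    have "R t (h' t)" using that(3)
    proof (induction rule: tensor_induct)
      case zero
      have "0 \<in> car (V \<otimes> W)"
        unfolding tprod_def subtensor_def vspace.simps by (rule tensor.span_zero)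
      then have "h' (0 + 0) = h' 0 + h' 0"
        using that(1) unfolding lin_def by blast
      then have "h' 0 = 0" by (metis add.right_neutral add_left_cancel)
      then show ?case using R0 by metis
    next
      case (add k x y t)
      have sc: "tscl k (ptensor V W x y) \<in> car (V \<otimes> W)"
        using ptensor_in[OF add(1,2)] tensor.span_scale by (simp add: tprod_def subtensor_def)
      have "h' (tscl k (ptensor V W x y) + t) = h' (tscl k (ptensor V W x y)) + h' t"
        using that(1) sc add unfolding lin_def by blast
      also have "h' (tscl k (ptensor V W x y)) = scl U k (h' (ptensor V W x y))"
        using that(1) ptensor_in[OF add(1,2)] unfolding lin_def by (simp add: tprod_def)
      also have "\<dots> = scl U k (\<phi> x y)" using that(2) add by simp
      finally have e: "h' (tscl k (ptensor V W x y) + t) = scl U k (\<phi> x y) + h' t" .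
      show ?case unfolding e by (rule Radd[OF Rscale[OF Rpure[OF add(1,2)]] add.IH])
    qed
    then show ?thesis using h by simp
  qed
  ultimately show ?thesis using h Rpure by blast
qed

lemma quot_map_exists:
  assumes V: "is_vspace V" and I: "module.subspace (scl V) I" "I \<subseteq> car V"
  shows "is_quot_map V I (quot_map V I)"
proof -
  interpret V: vector_space "scl V" using V by (simp add: is_vspace_def)
  interpret VV: vector_space_pair "scl V" "scl V"
    by (intro vector_space_pair.intro V.vector_space_axioms)
  have sub: "V.subspace (car V)" using V by (simp add: is_vspace_def)
  obtain S where S: "S \<subseteq> I" "V.independent S" "I \<subseteq> V.span S"
    using V.maximal_independent_subset[of I] by blast
  obtain Q where Q: "S \<subseteq> Q" "Q \<subseteq> car V" "V.independent Q" "car V \<subseteq> V.span Q"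
    using V.maximal_independent_subset_extend[of S "car V"] S I by blast
  have spS: "V.span S = I" using S I by (simp add: V.span_minimal subset_antisym)
  have spQ: "V.span Q = car V" using Q sub by (simp add: V.span_minimal subset_antisym)
  obtain p where p: "Vector_Spaces.linear (scl V) (scl V) p"
      "\<And>b. b \<in> Q \<Longrightarrow> p b = (if b \<in> S then 0 else b)"
    using VV.linear_independent_extend[OF Q(3), of "\<lambda>b. if b \<in> S then 0 else b"] by auto
  interpret p: Vector_Spaces.linear "scl V" "scl V" p by (fact p(1))
  have pS: "p x = 0" if "x \<in> I" for x
  proof -
    have "x \<in> V.span S" using that spS by simp
    then show ?thesis
      by (induction rule: V.span_induct_alt) (use p(2) Q(1) in \<open>auto simp: p.add p.scale\<close>)
  qed
  have pQ: "p x = x" if "x \<in> V.span (Q - S)" for x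
    using that
    by (induction rule: V.span_induct_alt) (use p(2) in \<open>auto simp: p.add p.scale\<close>)
  have dec: "\<exists>y z. x = y + z \<and> y \<in> I \<and> z \<in> V.span (Q - S)" if "x \<in> car V" for x
  proof -
    have "x \<in> V.span (S \<union> (Q - S))" using that spQ Q(1) by (simp add: Un_absorb1)
    then show ?thesis unfolding V.span_Un spS by auto
  qed
  have QS: "V.span (Q - S) \<subseteq> car V" using spQ V.span_mono[of "Q - S" Q] by auto
  have "is_quot_map V I p"
    unfolding is_quot_map_def lin_def
  proof (intro conjI ballI allI set_eqI)
    fix x assume x: "x \<in> car V"
    then obtain y z where yz: "x = y + z" "y \<in> I" "z \<in> V.span (Q - S)" using dec by blast
    then have px: "p x = z" by (simp add: p.add pS pQ)
    show "p x \<in> car V" using px yz QS by auto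
    show "p (p x) = p x" using px yz pQ by simp
  next
    fix x
    show "x \<in> {x \<in> car V. p x = 0} \<longleftrightarrow> x \<in> I"
    proof
      assume x: "x \<in> {x \<in> car V. p x = 0}"
      then obtain y z where yz: "x = y + z" "y \<in> I" "z \<in> V.span (Q - S)" using dec by blast
      then have "p x = z" by (simp add: p.add pS pQ)
      with x yz show "x \<in> I" by simp
    qed (use pS I in auto)
  qed (simp_all add: p.add p.scale)
  then show ?thesis unfolding quot_map_def by (rule someI[of "is_quot_map V I"])
qed

end

theory Submission
  imports Defs
begin

text \<open>
  Write \<open>m\<close>, \<open>\<Delta>\<close>, \<open>c\<close> for the structure maps of \<open>B\<close>. Since \<open>B\<close> is \<open>0\<close>-connected, \<open>E\<^sub>n(B)\<close> for
  \<open>n \<ge> 2\<close> is the space of primitive elements of degree \<open>n\<close> (\<open>E_comp_primitive\<close>,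
  \<open>primitive_E_comp\<close>), and every element of degree \<open>1\<close> is primitive. For \<open>x\<close> and \<open>y\<close> of degree
  \<open>1\<close>, expanding \<open>\<Delta> (x y) = \<Delta> x \<Delta> y\<close> gives

    \<open>\<Delta> (x y) - x y \<otimes> 1 - 1 \<otimes> x y = x \<otimes> y + c (x \<otimes> y)\<close>

  (\<open>reduced_comult_mult\<close>). On \<open>B\<^sup>1 \<otimes> B\<^sup>1\<close> the maps \<open>(1 + c) (h c) = f c\<close> vanish, so all elements
  \<open>m (h c t)\<close> are primitive of degree \<open>2\<close> and become zero in \<open>S(B)\<close>. Both claims follow.

  As \<open>f\<close> is minimal, \<open>h c t \<noteq> 0\<close> for some \<open>t\<close>, and then \<open>m (h c t) \<noteq> 0\<close> because \<open>m\<close> is injective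
  in these degrees. Thus the projection of \<open>B\<close> onto \<open>S(B)\<close> is not injective, the search for the
  first stable index does not stop at \<open>0\<close>, and from index \<open>1\<close> on it is the search for \<open>S(B)\<close>
  (\<open>sdeg_Suc\<close>).

  For the second claim, the projection has to commute with \<open>m\<close> and \<open>c\<close>, which carries \<open>m (h c t)\<close>
  to the corresponding element of \<open>S(B)\<close>. Commuting with \<open>c\<close> is the main work. It requires
  \<open>c (I \<otimes> B) \<subseteq> B \<otimes> I\<close> and \<open>c (B \<otimes> I) \<subseteq> I \<otimes> B\<close> for the ideal \<open>I\<close> generated by \<open>E(B)\<close>
  (\<open>braid_prim_ideal_left\<close>, \<open>braid_prim_ideal_right\<close>), even in degree \<open>1\<close>: the representatives
  of classes of degree \<open>1\<close> are determined only up to elements of \<open>I\<close>. The inclusions hold for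
  primitive elements by the compatibility of \<open>c\<close> with \<open>\<Delta>\<close> (\<open>braid_primitive_left\<close>,
  \<open>braid_primitive_right\<close>) and extend to the generated ideal by its compatibility with \<open>m\<close>.
\<close>


section \<open>Linear maps between spaces with carriers\<close>

lemma vspace_subspace: "is_vspace V \<Longrightarrow> module.subspace (scl V) (car V)"
  by (simp add: is_vspace_def)

lemma vspace_module: "is_vspace V \<Longrightarrow> module (scl V)"
  by (simp add: is_vspace_def module_iff_vector_space)

lemma vspace_0: "is_vspace V \<Longrightarrow> 0 \<in> car V"
  using module.subspace_0[OF vspace_module vspace_subspace] by blast

lemma vspace_diff: "is_vspace V \<Longrightarrow> x \<in> car V \<Longrightarrow> y \<in> car V \<Longrightarrow> x - y \<in> car V"
  using module.subspace_diff[OF vspace_module vspace_subspace] by blast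

lemma tprod_simps [simp]: "scl (V \<otimes> W) = tscl"
  by (simp add: tprod_def)

lemma lin_in: "lin V W f \<Longrightarrow> x \<in> car V \<Longrightarrow> f x \<in> car W"
  by (simp add: lin_def)

lemma lin_add: "lin V W f \<Longrightarrow> x \<in> car V \<Longrightarrow> y \<in> car V \<Longrightarrow> f (x + y) = f x + f y"
  by (simp add: lin_def)

lemma lin_scale: "lin V W f \<Longrightarrow> x \<in> car V \<Longrightarrow> f (scl V k x) = scl W k (f x)"
  by (simp add: lin_def)

lemma lin_zero:
  assumes "is_vspace V" "lin V W f" shows "f 0 = 0"
  using lin_add[OF assms(2), of 0 0] vspace_0[OF assms(1)] by simp

lemma lin_diff:
  assumes "is_vspace V" "lin V W f" "x \<in> car V" "y \<in> car V"
  shows "f (x - y) = f x - f y"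
  using lin_add[OF assms(2) vspace_diff[OF assms(1,3,4)] assms(4)] by simp

lemma lin_sum:
  assumes V: "is_vspace V" and f: "lin V W f" and "\<And>i. i \<in> F \<Longrightarrow> x i \<in> car V"
  shows "f (sum x F) = (\<Sum>i\<in>F. f (x i))"
proof -
  interpret V: module "scl V" by (rule vspace_module[OF V])
  show ?thesis using assms(3)
  proof (induction F rule: infinite_finite_induct)
    case (insert i F)
    then have "sum x F \<in> car V"
      by (auto intro: V.subspace_sum[OF vspace_subspace[OF V]])
    with insert show ?case by (simp add: lin_add[OF f])
  qed (simp_all add: lin_zero[OF V f])
qed

lemma lin_ident: "lin V V (\<lambda>x. x)" and lin_id: "lin V V id"
  by (simp_all add: lin_def)

lemma lin_comp: "lin U V f \<Longrightarrow> lin V W g \<Longrightarrow> lin U W (\<lambda>x. g (f x))"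
  by (simp add: lin_def)

lemma lin_plus:
  assumes "is_vspace W" "lin V W f" "lin V W g"
  shows "lin V W (\<lambda>x. f x + g x)"
proof -
  interpret W: module "scl W" by (rule vspace_module[OF assms(1)])
  show ?thesis
    using assms vspace_closed[OF assms(1)] by (simp add: lin_def W.scale_right_distrib algebra_simps)
qed

lemma lin_minus:
  assumes "is_vspace W" "lin V W f" "lin V W g"
  shows "lin V W (\<lambda>x. f x - g x)"
proof -
  interpret W: module "scl W" by (rule vspace_module[OF assms(1)])
  show ?thesis
    using assms vspace_diff[OF assms(1)] by (simp add: lin_def W.scale_right_diff_distrib algebra_simps)
qed

lemma lin_kernel_subspace:
  assumes "is_vspace V" "is_vspace W" "lin V W f" "module.subspace (scl V) A" "A \<subseteq> car V"
  shows "module.subspace (scl V) {x \<in> A. f x = 0}"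
proof -
  interpret V: module "scl V" by (rule vspace_module[OF assms(1)])
  interpret W: module "scl W" by (rule vspace_module[OF assms(2)])
  show ?thesis
    using assms(4,5) lin_add[OF assms(3)] lin_scale[OF assms(3)] lin_zero[OF assms(1,3)]
    by (auto simp: V.subspace_def subset_iff)
qed

lemma lin_image_subspace:
  assumes f: "lin V W f" and V: "is_vspace V" and W: "is_vspace W"
    and A: "module.subspace (scl V) A" "A \<subseteq> car V"
  shows "module.subspace (scl W) (f ` A)"
proof -
  interpret V: module "scl V" by (rule vspace_module[OF V])
  interpret W: module "scl W" by (rule vspace_module[OF W])
  show ?thesis
    unfolding W.subspace_def
  proof (intro conjI ballI allI)
    show "0 \<in> f ` A" using V.subspace_0[OF A(1)] lin_zero[OF V f] by force
    show "u + v \<in> f ` A" if "u \<in> f ` A" "v \<in> f ` A" for u v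
      using that A(2) V.subspace_add[OF A(1)] lin_add[OF f] by (auto simp: subset_iff) (metis image_eqI)
    show "scl W k u \<in> f ` A" if "u \<in> f ` A" for k u
      using that A(2) V.subspace_scale[OF A(1)] lin_scale[OF f] by (auto simp: subset_iff) (metis image_eqI)
  qed
qed

lemma lin_extends:
  fixes V :: "('k::field, 'a::ab_group_add, 'm) vspace_scheme"
    and W :: "('k, 'b::ab_group_add, 'n) vspace_scheme"
  assumes V: "is_vspace V" and W: "is_vspace W" and f: "lin V W f"
  shows "\<exists>g. Vector_Spaces.linear (scl V) (scl W) g \<and> (\<forall>x\<in>car V. g x = f x)"
proof -
  interpret V: vector_space "scl V" using V by (simp add: is_vspace_def)
  interpret W: vector_space "scl W" using W by (simp add: is_vspace_def)
  interpret P: vector_space_pair "scl V" "scl W"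
    by (intro vector_space_pair.intro V.vector_space_axioms W.vector_space_axioms)
  obtain Q where Q: "Q \<subseteq> car V" "V.independent Q" "car V \<subseteq> V.span Q"
    using V.maximal_independent_subset[of "car V"] by blast
  obtain g where g: "Vector_Spaces.linear (scl V) (scl W) g" "\<And>x. x \<in> Q \<Longrightarrow> g x = f x"
    using P.linear_independent_extend[OF Q(2), of f] by blast
  interpret g: Vector_Spaces.linear "scl V" "scl W" g by (fact g(1))
  have "x \<in> car V \<and> g x = f x" if "x \<in> V.span Q" for x
    using that
  proof (induction rule: V.span_induct_alt)
    case base
    show ?case using vspace_0[OF V] lin_zero[OF V f] by (simp add: g.zero)
  next
    case (step c x y)
    then show ?case
      using Q(1) g(2) vspace_closed[OF V]
      by (auto simp: g.add g.scale lin_add[OF f] lin_scale[OF f])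
  qed
  with Q(3) g(1) show ?thesis by blast
qed

text \<open>
  Linear maps over a field have generalized inverses: choose preimages in \<open>A\<close> of a basis of
  the image of \<open>A\<close>. Then \<open>a - s (g a)\<close> lies in the kernel for all \<open>a\<close> in \<open>A\<close>, which is how
  kernels are moved through tensor products below.
\<close>

lemma lin_quasi_inverse:
  fixes V :: "('k::field, 'a::ab_group_add, 'm) vspace_scheme"
    and W :: "('k, 'b::ab_group_add, 'n) vspace_scheme"
  assumes V: "is_vspace V" and W: "is_vspace W" and g: "lin V W g"
    and A: "module.subspace (scl V) A" "A \<subseteq> car V"
  shows "\<exists>s. lin W V s \<and> (\<forall>w. s w \<in> A) \<and> (\<forall>a\<in>A. g (s (g a)) = g a)"
proof -
  interpret V: vector_space "scl V" using V by (simp add: is_vspace_def)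
  interpret W: vector_space "scl W" using W by (simp add: is_vspace_def)
  interpret P: vector_space_pair "scl V" "scl W"
    by (intro vector_space_pair.intro V.vector_space_axioms W.vector_space_axioms)
  obtain g' where g': "Vector_Spaces.linear (scl V) (scl W) g'" "\<And>x. x \<in> car V \<Longrightarrow> g' x = g x"
    using lin_extends[OF V W g] by blast
  obtain s where s: "range s \<subseteq> A" "Vector_Spaces.linear (scl W) (scl V) s"
      "\<And>w. w \<in> g' ` A \<Longrightarrow> g' (s w) = w"
    using P.linear_exists_right_inverse_on[OF g'(1) A(1)] by blast
  interpret s: Vector_Spaces.linear "scl W" "scl V" s by (fact s(2))
  have "lin W V s" using s(1) A(2) by (auto simp: lin_def s.add s.scale)
  moreover have "g (s (g a)) = g a" if "a \<in> A" for a
  proof -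
    have "s (g a) \<in> car V" using s(1) A(2) by blast
    then show ?thesis using s(3)[of "g a"] that A(2) g'(2) by (metis image_eqI subsetD)
  qed
  ultimately show ?thesis using s(1) by blast
qed


section \<open>Subspaces and maps of tensor products\<close>

lemma subtensor_subspace: "tensor.subspace (subtensor V W A C)"
  by (simp add: subtensor_def)

lemma subtensor_mono: "A \<subseteq> A' \<Longrightarrow> C \<subseteq> C' \<Longrightarrow> subtensor V W A C \<subseteq> subtensor V W A' C'"
  unfolding subtensor_def by (rule tensor.span_mono) blast

lemma subtensor_car: "subtensor V W (car V) (car W) = car (V \<otimes> W)"
  by (simp add: tprod_def)

lemma subtensor_sub_car: "A \<subseteq> car V \<Longrightarrow> C \<subseteq> car W \<Longrightarrow> subtensor V W A C \<subseteq> car (V \<otimes> W)"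
  using subtensor_mono[of A "car V" C "car W" V W] by (simp add: subtensor_car)

lemma ptensor_subtensor: "x \<in> A \<Longrightarrow> y \<in> C \<Longrightarrow> ptensor V W x y \<in> subtensor V W A C"
  unfolding subtensor_def by (rule tensor.span_base) blast

lemma lin_ptensor_right: "x \<in> car V \<Longrightarrow> lin W (V \<otimes> W) (ptensor V W x)"
  and lin_ptensor_left: "y \<in> car W \<Longrightarrow> lin V (V \<otimes> W) (\<lambda>x. ptensor V W x y)"
  using bilin_ptensor[of V W] by (simp_all add: bilin_def)

lemma lin_tensor_into:
  assumes U: "is_vspace U" and F: "lin (V \<otimes> W) U F" and A: "A \<subseteq> car V" "C \<subseteq> car W"
    and S: "module.subspace (scl U) S"
    and pure: "\<And>x y. x \<in> A \<Longrightarrow> y \<in> C \<Longrightarrow> F (ptensor V W x y) \<in> S"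
    and t: "t \<in> subtensor V W A C"
  shows "F t \<in> S"
proof -
  interpret U: module "scl U" by (rule vspace_module[OF U])
  have "t \<in> car (V \<otimes> W) \<and> F t \<in> S"
    using t unfolding subtensor_def
  proof (induction rule: tensor.span_induct_alt)
    case base
    show ?case
      using lin_zero[OF is_vspace_tprod F] vspace_0[OF is_vspace_tprod, of V W] U.subspace_0[OF S]
      by metis
  next
    case (step c u v)
    then obtain x y where u: "u = ptensor V W x y" "x \<in> A" "y \<in> C" by blast
    have uc: "u \<in> car (V \<otimes> W)" using u A by (auto intro: ptensor_in)
    have cu: "tscl c u \<in> car (V \<otimes> W)"
      using vspace_closed(2)[OF is_vspace_tprod uc] by simp
    have "F (tscl c u + v) = scl U c (F u) + F v"
      using step uc cu lin_add[OF F cu, of v] lin_scale[OF F uc] by simp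
    then have "F (tscl c u + v) \<in> S"
      using step pure[OF u(2,3)] u(1) U.subspace_add[OF S] U.subspace_scale[OF S] by metis
    moreover have "tscl c u + v \<in> car (V \<otimes> W)"
      using step cu vspace_closed(1)[OF is_vspace_tprod, of _ V W] by blast
    ultimately show ?case by (intro conjI)
  qed
  then show ?thesis by simp
qed

lemma lin_tensor_eq:
  assumes U: "is_vspace U" and F: "lin (V \<otimes> W) U F" and G: "lin (V \<otimes> W) U G"
    and A: "A \<subseteq> car V" "C \<subseteq> car W"
    and pure: "\<And>x y. x \<in> A \<Longrightarrow> y \<in> C \<Longrightarrow> F (ptensor V W x y) = G (ptensor V W x y)"
    and t: "t \<in> subtensor V W A C"
  shows "F t = G t"
proof -
  interpret U: module "scl U" by (rule vspace_module[OF U])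
  have "F t - G t \<in> {0}"
    by (rule lin_tensor_into[OF U lin_minus[OF U F G] A _ _ t]) (simp_all add: pure)
  then show ?thesis by simp
qed

lemma lin_tensor_eqI:
  assumes "is_vspace U" "lin (V \<otimes> W) U F" "lin (V \<otimes> W) U G"
    and "\<And>x y. x \<in> car V \<Longrightarrow> y \<in> car W \<Longrightarrow> F (ptensor V W x y) = G (ptensor V W x y)"
    and "t \<in> car (V \<otimes> W)"
  shows "F t = G t"
  by (rule lin_tensor_eq[where F = F and G = G and t = t, OF assms(1-3) order_refl order_refl])
     (simp_all add: assms(4,5) subtensor_car)

text \<open>
  The type of tensors is itself a vector space. Maps that are linear on all of it, such as
  \<open>tmap\<close> and \<open>tassoc\<close>, map one tensor product into another as soon as they do so on pure
  tensors.
\<close>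

lemma lin_tensorI:
  assumes "\<And>s t. F (s + t) = F s + F t" and "\<And>k t. F (tscl k t) = tscl k (F t)"
    and "\<And>x y. x \<in> car V \<Longrightarrow> y \<in> car W \<Longrightarrow> F (ptensor V W x y) \<in> car (V' \<otimes> W')"
  shows "lin (V \<otimes> W) (V' \<otimes> W') F"
proof -
  have U: "is_vspace \<lparr>scl = tscl, car = UNIV\<rparr>"
    by (simp add: is_vspace_def vector_space_tscl)
  have F: "lin (V \<otimes> W) \<lparr>scl = tscl, car = UNIV\<rparr> F"
    by (simp add: lin_def assms(1,2))
  have "F t \<in> car (V' \<otimes> W')" if "t \<in> car (V \<otimes> W)" for t
    using lin_tensor_into[OF U F order_refl order_refl, of "car (V' \<otimes> W')" t]
      vspace_subspace[OF is_vspace_tprod, of V' W'] that assms(3) by (simp add: subtensor_car)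
  then show ?thesis by (simp add: lin_def assms(1,2))
qed

lemma lin_tensor_leftI:
  assumes "\<And>s t. F (s + t) = F s + F t" and "\<And>k t. F (tscl k t) = tscl k (F t)"
    and pure: "\<And>x y z. x \<in> car U \<Longrightarrow> y \<in> car V \<Longrightarrow> z \<in> car W \<Longrightarrow>
      F (ptensor (U \<otimes> V) W (ptensor U V x y) z) \<in> car (V' \<otimes> W')"
  shows "lin (U \<otimes> V \<otimes> W) (V' \<otimes> W') F"
proof (rule lin_tensorI)
  fix s z assume s: "s \<in> car (U \<otimes> V)" and z: "z \<in> car W"
  have T: "is_vspace \<lparr>scl = tscl, car = UNIV\<rparr>"
    by (simp add: is_vspace_def vector_space_tscl)
  have "lin (U \<otimes> V \<otimes> W) \<lparr>scl = tscl, car = UNIV\<rparr> F"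
    by (simp add: lin_def assms(1,2))
  note F = lin_comp[OF lin_ptensor_left[OF z] this]
  show "F (ptensor (U \<otimes> V) W s z) \<in> car (V' \<otimes> W')"
    using lin_tensor_into[OF T F order_refl order_refl, of "car (V' \<otimes> W')" s]
      vspace_subspace[OF is_vspace_tprod, of V' W'] s z pure by (simp add: subtensor_car)
qed (fact assms)+

lemma lin_tensor_rightI:
  assumes "\<And>s t. F (s + t) = F s + F t" and "\<And>k t. F (tscl k t) = tscl k (F t)"
    and pure: "\<And>x y z. x \<in> car U \<Longrightarrow> y \<in> car V \<Longrightarrow> z \<in> car W \<Longrightarrow>
      F (ptensor U (V \<otimes> W) x (ptensor V W y z)) \<in> car (V' \<otimes> W')"
  shows "lin (U \<otimes> (V \<otimes> W)) (V' \<otimes> W') F"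
proof (rule lin_tensorI)
  fix x s assume x: "x \<in> car U" and s: "s \<in> car (V \<otimes> W)"
  have T: "is_vspace \<lparr>scl = tscl, car = UNIV\<rparr>"
    by (simp add: is_vspace_def vector_space_tscl)
  have "lin (U \<otimes> (V \<otimes> W)) \<lparr>scl = tscl, car = UNIV\<rparr> F"
    by (simp add: lin_def assms(1,2))
  note F = lin_comp[OF lin_ptensor_right[OF x] this]
  show "F (ptensor U (V \<otimes> W) x s) \<in> car (V' \<otimes> W')"
    using lin_tensor_into[OF T F order_refl order_refl, of "car (V' \<otimes> W')" s]
      vspace_subspace[OF is_vspace_tprod, of V' W'] s x pure by (simp add: subtensor_car)
qed (fact assms)+

lemma tmap_add: "tmap V W f g (s + t) = tmap V W f g s + tmap V W f g t"
  and tmap_scale: "tmap V W f g (tscl k t) = tscl k (tmap V W f g t)"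
  by (simp_all add: tmap_def tscl_def fun_eq_iff)

lemma tmap_0: "tmap V W f g 0 = 0"
  by (simp add: tmap_def fun_eq_iff)

lemma tmap_sum: "tmap V W f g (\<Sum>i\<in>F. t i) = (\<Sum>i\<in>F. tmap V W f g (t i))"
proof -
  have "sum (tmap V W f g \<circ> t) F = tmap V W f g (sum t F)"
    by (rule sum_comp_morphism) (rule tmap_0, rule tmap_add)
  then show ?thesis by (simp only: comp_def)
qed

lemma tassoc_add: "tassoc U V W (s + t) = tassoc U V W s + tassoc U V W t"
  and tassoc_inv_add: "tassoc_inv U V W (p + q) = tassoc_inv U V W p + tassoc_inv U V W q"
  by (simp_all add: tassoc_def tassoc_inv_def fun_eq_iff)

lemma lin_tmap:
  assumes "lin V V' f" "lin W W' g"
  shows "lin (V \<otimes> W) (V' \<otimes> W') (tmap V' W' f g)"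
  by (rule lin_tensorI)
     (simp_all add: tmap_add tmap_scale tmap_ptensor[OF assms] ptensor_in lin_in[OF assms(1)]
        lin_in[OF assms(2)])

lemma tmap_id_minus:
  assumes f: "lin W W' f" and g: "lin W W' g" and W': "is_vspace W'" and t: "t \<in> car (V \<otimes> W)"
  shows "tmap V W' id (\<lambda>x. f x - g x) t = tmap V W' id f t - tmap V W' id g t"
proof (rule lin_tensor_eqI[where F = "tmap V W' id (\<lambda>x. f x - g x)"
      and G = "\<lambda>t. tmap V W' id f t - tmap V W' id g t" and t = t,
      OF is_vspace_tprod _ _ _ t])
  note fg = lin_minus[OF W' f g]
  show "lin (V \<otimes> W) (V \<otimes> W') (tmap V W' id (\<lambda>x. f x - g x))"
    by (rule lin_tmap[OF lin_id fg])
  show "lin (V \<otimes> W) (V \<otimes> W') (\<lambda>t. tmap V W' id f t - tmap V W' id g t)"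
    by (rule lin_minus[OF is_vspace_tprod lin_tmap[OF lin_id f] lin_tmap[OF lin_id g]])
  fix x y assume x: "x \<in> car V" and y: "y \<in> car W"
  show "tmap V W' id (\<lambda>x. f x - g x) (ptensor V W x y)
      = tmap V W' id f (ptensor V W x y) - tmap V W' id g (ptensor V W x y)"
    using x y lin_diff[OF W' lin_ptensor_right[OF x, of W'] lin_in[OF f y] lin_in[OF g y]]
    unfolding tmap_ptensor[OF lin_id fg x y] tmap_ptensor[OF lin_id f x y] tmap_ptensor[OF lin_id g x y]
    by simp
qed

lemma tmap_minus_id:
  assumes f: "lin V V' f" and g: "lin V V' g" and V': "is_vspace V'" and t: "t \<in> car (V \<otimes> W)"
  shows "tmap V' W (\<lambda>x. f x - g x) id t = tmap V' W f id t - tmap V' W g id t"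
proof (rule lin_tensor_eqI[where F = "tmap V' W (\<lambda>x. f x - g x) id"
      and G = "\<lambda>t. tmap V' W f id t - tmap V' W g id t" and t = t,
      OF is_vspace_tprod _ _ _ t])
  note fg = lin_minus[OF V' f g]
  show "lin (V \<otimes> W) (V' \<otimes> W) (tmap V' W (\<lambda>x. f x - g x) id)"
    by (rule lin_tmap[OF fg lin_id])
  show "lin (V \<otimes> W) (V' \<otimes> W) (\<lambda>t. tmap V' W f id t - tmap V' W g id t)"
    by (rule lin_minus[OF is_vspace_tprod lin_tmap[OF f lin_id] lin_tmap[OF g lin_id]])
  fix x y assume x: "x \<in> car V" and y: "y \<in> car W"
  show "tmap V' W (\<lambda>x. f x - g x) id (ptensor V W x y)
      = tmap V' W f id (ptensor V W x y) - tmap V' W g id (ptensor V W x y)"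
    using x y lin_diff[OF V' lin_ptensor_left[OF y, of V'] lin_in[OF f x] lin_in[OF g x]]
    unfolding tmap_ptensor[OF fg lin_id x y] tmap_ptensor[OF f lin_id x y] tmap_ptensor[OF g lin_id x y]
    by simp
qed

lemma lin_tassoc:
  assumes "is_vspace W"
  shows "lin (U \<otimes> V \<otimes> W) (U \<otimes> (V \<otimes> W)) (tassoc U V W)"
  by (rule lin_tensor_leftI)
     (simp_all add: tassoc_ptensor[OF assms] ptensor_in,
      simp_all add: tassoc_def tscl_def fun_eq_iff)

lemma lin_tassoc_inv:
  assumes "is_vspace U"
  shows "lin (U \<otimes> (V \<otimes> W)) (U \<otimes> V \<otimes> W) (tassoc_inv U V W)"
  by (rule lin_tensor_rightI)
     (simp_all add: tassoc_inv_ptensor[OF assms] ptensor_in,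
      simp_all add: tassoc_inv_def tscl_def fun_eq_iff)

text \<open>
  Over a field, \<open>ker (V \<otimes> g) = V \<otimes> ker g\<close>. With \<open>s\<close> a generalized inverse of \<open>g\<close>, a tensor \<open>t\<close>
  in the kernel of \<open>V \<otimes> g\<close> equals its image under \<open>V \<otimes> (1 - s g)\<close>, and \<open>1 - s g\<close> takes values
  in \<open>ker g\<close>.
\<close>

lemma tmap_kernel_right:
  assumes W: "is_vspace W" and W': "is_vspace W'" and g: "lin W W' g"
    and A: "module.subspace (scl W) A" "A \<subseteq> car W"
    and t: "t \<in> subtensor V W (car V) A" and 0: "tmap V W' id g t = 0"
  shows "t \<in> subtensor V W (car V) {a \<in> A. g a = 0}"
proof -
  interpret W: module "scl W" by (rule vspace_module[OF W])
  obtain s where s: "lin W' W s" "\<And>w. s w \<in> A" "\<And>a. a \<in> A \<Longrightarrow> g (s (g a)) = g a"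
    using lin_quasi_inverse[OF W W' g A] by blast
  define r where "r w = w - s (g w)" for w
  have r: "lin W W r"
    unfolding r_def by (rule lin_minus[OF W lin_ident lin_comp[OF g s(1)]])
  have rA: "r a \<in> {a \<in> A. g a = 0}" if "a \<in> A" for a
    using that s(2,3) W.subspace_diff[OF A(1)] lin_diff[OF W g, of a "s (g a)"] subsetD[OF A(2)]
    by (auto simp: r_def)
  have "tmap V W id r t + tmap V W id s (tmap V W' id g t) = t"
  proof (rule lin_tensor_eq[OF is_vspace_tprod _ lin_ident order_refl order_refl])
    show "lin (V \<otimes> W) (V \<otimes> W) (\<lambda>t. tmap V W id r t + tmap V W id s (tmap V W' id g t))"
      by (intro lin_plus is_vspace_tprod lin_tmap lin_id r lin_comp[OF lin_tmap lin_tmap] g s)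
    show "t \<in> subtensor V W (car V) (car W)"
      using t subtensor_mono[OF order_refl A(2)] by blast
    fix x y assume x: "x \<in> car V" and y: "y \<in> car W"
    have "ptensor V W x (r y) + ptensor V W x (s (g y)) = ptensor V W x (r y + s (g y))"
      using lin_add[OF lin_ptensor_right[OF x, of W] lin_in[OF r y]]
        lin_in[OF s(1) lin_in[OF g y]] by simp
    then show "tmap V W id r (ptensor V W x y) + tmap V W id s (tmap V W' id g (ptensor V W x y))
        = ptensor V W x y"
      using x y lin_in[OF g y]
      by (simp add: tmap_ptensor[OF lin_id r] tmap_ptensor[OF lin_id g] tmap_ptensor[OF lin_id s(1)]
          r_def)
  qed
  then have "tmap V W id r t = t" by (simp add: 0 tmap_0)
  moreover have "tmap V W id r t \<in> subtensor V W (car V) {a \<in> A. g a = 0}"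
    using rA A(2)
    by (intro lin_tensor_into[OF is_vspace_tprod lin_tmap[OF lin_id r] order_refl A(2) _ _ t])
       (auto simp: subtensor_subspace subset_iff tmap_ptensor[OF lin_id r] intro!: ptensor_subtensor)
  ultimately show ?thesis by simp
qed

lemma tmap_kernel_left:
  assumes V: "is_vspace V" and V': "is_vspace V'" and g: "lin V V' g"
    and A: "module.subspace (scl V) A" "A \<subseteq> car V"
    and t: "t \<in> subtensor V W A (car W)" and 0: "tmap V' W g id t = 0"
  shows "t \<in> subtensor V W {a \<in> A. g a = 0} (car W)"
proof -
  interpret V: module "scl V" by (rule vspace_module[OF V])
  obtain s where s: "lin V' V s" "\<And>w. s w \<in> A" "\<And>a. a \<in> A \<Longrightarrow> g (s (g a)) = g a"
    using lin_quasi_inverse[OF V V' g A] by blast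
  define r where "r w = w - s (g w)" for w
  have r: "lin V V r"
    unfolding r_def by (rule lin_minus[OF V lin_ident lin_comp[OF g s(1)]])
  have rA: "r a \<in> {a \<in> A. g a = 0}" if "a \<in> A" for a
    using that s(2,3) V.subspace_diff[OF A(1)] lin_diff[OF V g, of a "s (g a)"] subsetD[OF A(2)]
    by (auto simp: r_def)
  have "tmap V W r id t + tmap V W s id (tmap V' W g id t) = t"
  proof (rule lin_tensor_eq[OF is_vspace_tprod _ lin_ident order_refl order_refl])
    show "lin (V \<otimes> W) (V \<otimes> W) (\<lambda>t. tmap V W r id t + tmap V W s id (tmap V' W g id t))"
      by (intro lin_plus is_vspace_tprod lin_tmap lin_id r lin_comp[OF lin_tmap lin_tmap] g s)
    show "t \<in> subtensor V W (car V) (car W)"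
      using t subtensor_mono[OF A(2) order_refl] by blast
    fix x y assume x: "x \<in> car V" and y: "y \<in> car W"
    have "ptensor V W (r x) y + ptensor V W (s (g x)) y = ptensor V W (r x + s (g x)) y"
      using lin_add[OF lin_ptensor_left[OF y, of V] lin_in[OF r x]]
        lin_in[OF s(1) lin_in[OF g x]] by simp
    then show "tmap V W r id (ptensor V W x y) + tmap V W s id (tmap V' W g id (ptensor V W x y))
        = ptensor V W x y"
      using x y lin_in[OF g x]
      by (simp add: tmap_ptensor[OF r lin_id] tmap_ptensor[OF g lin_id] tmap_ptensor[OF s(1) lin_id]
          r_def)
  qed
  then have "tmap V W r id t = t" by (simp add: 0 tmap_0)
  moreover have "tmap V W r id t \<in> subtensor V W {a \<in> A. g a = 0} (car W)"
    using rA A(2)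
    by (intro lin_tensor_into[OF is_vspace_tprod lin_tmap[OF r lin_id] A(2) order_refl _ _ t])
       (auto simp: subtensor_subspace subset_iff tmap_ptensor[OF r lin_id] intro!: ptensor_subtensor)
  ultimately show ?thesis by simp
qed

lemma ptensor_ground_cancel_left:
  assumes W: "is_vspace W" and xy: "x \<in> car W" "y \<in> car W"
    and eq: "ptensor ground W 1 x = ptensor ground W 1 y"
  shows "x = y"
proof (rule ccontr)
  assume "x \<noteq> y"
  then obtain l where l: "lin W ground l" "l (x - y) \<noteq> 0"
    using functionals_separate[OF W, of "x - y"] by auto
  have "bilin ground W ground (\<lambda>k z. k * l z)"
    using l(1) by (auto simp: bilin_def lin_def ground_def algebra_simps)
  then have "l x = l y"
    using fun_cong[OF eq, of "\<lambda>k z. k * l z"] by (simp add: ptensor_def)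
  with l(2) show False using lin_diff[OF W l(1) xy] by simp
qed

lemma ptensor_ground_cancel_right:
  assumes V: "is_vspace V" and xy: "x \<in> car V" "y \<in> car V"
    and eq: "ptensor V ground x 1 = ptensor V ground y 1"
  shows "x = y"
proof (rule ccontr)
  assume "x \<noteq> y"
  then obtain l where l: "lin V ground l" "l (x - y) \<noteq> 0"
    using functionals_separate[OF V, of "x - y"] by auto
  have "bilin V ground ground (\<lambda>z k. l z * k)"
    using l(1) by (auto simp: bilin_def lin_def ground_def algebra_simps)
  then have "l x = l y"
    using fun_cong[OF eq, of "\<lambda>z k. l z * k"] by (simp add: ptensor_def)
  with l(2) show False using lin_diff[OF V l(1) xy] by simp
qed


section \<open>Graded braided bialgebras on elements\<close>

locale graded_braided_bialg =
  fixes B :: "('k::field, 'a::ab_group_add) bialg"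
  assumes graded: "graded_braided_bialgebra B"
begin

abbreviation tens :: "'a \<Rightarrow> 'a \<Rightarrow> ('k, 'a, 'a) tensor" (infixl \<open>\<odot>\<close> 75) where
  "x \<odot> y \<equiv> ptensor B B x y"

abbreviation unit_elem :: 'a (\<open>\<one>\<close>) where
  "\<one> \<equiv> unit_map B 1"

lemma vspace: "is_vspace B"
  and lin_braid: "lin (B \<otimes> B) (B \<otimes> B) (braid B)"
  and lin_mult: "lin (B \<otimes> B) B (mult B)"
  and lin_comult: "lin B (B \<otimes> B) (comult B)"
  and lin_counit: "lin B ground (counit B)"
  and one_car: "\<one> \<in> car B"
  using graded
  unfolding graded_braided_bialgebra_def braided_bialgebra_def braided_algebra_def
    braided_coalgebra_def braided_vspace_def
  by (auto simp: lin_def ground_def)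

sublocale vector_space "scl B"
  using vspace by (simp add: is_vspace_def)

lemma mult_one: "x \<in> car B \<Longrightarrow> mult B (\<one> \<odot> x) = x" "x \<in> car B \<Longrightarrow> mult B (x \<odot> \<one>) = x"
  and braid_one: "x \<in> car B \<Longrightarrow> braid B (\<one> \<odot> x) = x \<odot> \<one>" "x \<in> car B \<Longrightarrow> braid B (x \<odot> \<one>) = \<one> \<odot> x"
  and counit_one: "counit B \<one> = 1"
  and counit_left: "x \<in> car B \<Longrightarrow> tmap ground B (counit B) id (comult B x) = ptensor ground B 1 x"
  and counit_right: "x \<in> car B \<Longrightarrow> tmap B ground id (counit B) (comult B x) = ptensor B ground x 1"
  using graded
  unfolding graded_braided_bialgebra_def braided_bialgebra_def braided_algebra_def
    braided_coalgebra_def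
  by simp_all

lemma braid_mult_left: "t \<in> car (B \<otimes> B \<otimes> B) \<Longrightarrow>
    braid B (tmap B B (mult B) id t)
      = tmap B B id (mult B) (tassoc B B B (braid_l B (braid_r B t)))"
  and braid_mult_right: "t \<in> car (B \<otimes> B \<otimes> B) \<Longrightarrow>
    braid B (tmap B B id (mult B) (tassoc B B B t))
      = tmap B B (mult B) id (braid_r B (braid_l B t))"
  and comult_braid_left: "w \<in> car (B \<otimes> B) \<Longrightarrow>
    tmap (B \<otimes> B) B (comult B) id (braid B w)
      = braid_r B (braid_l B (tassoc_inv B B B (tmap B (B \<otimes> B) id (comult B) w)))"
  and comult_braid_right: "w \<in> car (B \<otimes> B) \<Longrightarrow>
    tmap B (B \<otimes> B) id (comult B) (braid B w)
      = tassoc B B B (braid_l B (braid_r B (tmap (B \<otimes> B) B (comult B) id w)))"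
  and comult_mult: "w \<in> car (B \<otimes> B) \<Longrightarrow>
    comult B (mult B w)
      = tmap B B (mult B) (mult B)
          (braid_mid B (tmap (B \<otimes> B) (B \<otimes> B) (comult B) (comult B) w))"
  using graded
  unfolding graded_braided_bialgebra_def braided_bialgebra_def braided_algebra_def
    braided_coalgebra_def
  by simp_all

lemma direct_sum: "direct_sum B (hcomp B)"
  and mult_hcomp: "w \<in> hcomp2 B a b \<Longrightarrow> mult B w \<in> hcomp B (a + b)"
  and comult_hcomp: "x \<in> hcomp B n \<Longrightarrow>
    comult B x \<in> tensor.span (\<Union>{hcomp2 B a b | a b. a + b = n})"
  and braid_hcomp: "w \<in> hcomp2 B a b \<Longrightarrow> braid B w \<in> hcomp2 B b a"
  and counit_hcomp: "n > 0 \<Longrightarrow> x \<in> hcomp B n \<Longrightarrow> counit B x = 0"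
  using graded unfolding graded_braided_bialgebra_def by (simp_all add: image_subset_iff)

lemma hcomp_subspace: "subspace (hcomp B n)" and hcomp_car: "hcomp B n \<subseteq> car B"
  using direct_sum by (simp_all add: direct_sum_def)

lemma hcomp_in: "x \<in> hcomp B n \<Longrightarrow> x \<in> car B"
  using hcomp_car by blast

lemma tens_in [intro, simp]: "x \<in> car B \<Longrightarrow> y \<in> car B \<Longrightarrow> x \<odot> y \<in> car (B \<otimes> B)"
  by (rule ptensor_in)

lemma mult_in: "x \<in> car B \<Longrightarrow> y \<in> car B \<Longrightarrow> mult B (x \<odot> y) \<in> car B"
  by (simp add: lin_in[OF lin_mult])

lemma hcomp2_car: "hcomp2 B a b \<subseteq> car (B \<otimes> B)"
  unfolding hcomp2_def by (intro subtensor_sub_car hcomp_car)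

lemma tens_hcomp2: "x \<in> hcomp B a \<Longrightarrow> y \<in> hcomp B b \<Longrightarrow> x \<odot> y \<in> hcomp2 B a b"
  unfolding hcomp2_def by (rule ptensor_subtensor)


subsection \<open>Homogeneous parts\<close>

lemma homogeneous_parts_hpart:
  assumes "x \<in> car B"
  shows "homogeneous_parts (hcomp B) x (\<lambda>n. hpart B n x)"
proof -
  have "\<exists>!f. homogeneous_parts (hcomp B) x f"
    using direct_sum assms by (simp add: direct_sum_def)
  from theI'[OF this] show ?thesis by (simp add: hpart_def)
qed

lemma hpartI:
  assumes x: "x \<in> car B" and f: "homogeneous_parts (hcomp B) x f"
  shows "hpart B n x = f n"
proof -
  have "\<exists>!f. homogeneous_parts (hcomp B) x f"
    using direct_sum x by (simp add: direct_sum_def)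
  with f homogeneous_parts_hpart[OF x] have "f = (\<lambda>n. hpart B n x)" by blast
  then show ?thesis by simp
qed

lemma hpart_hcomp: "x \<in> car B \<Longrightarrow> hpart B n x \<in> hcomp B n"
  using homogeneous_parts_hpart by (simp add: homogeneous_parts_def)

lemma homogeneous_partsI:
  assumes "\<And>n. f n \<in> hcomp B n" "finite F" "\<And>n. n \<notin> F \<Longrightarrow> f n = 0" "x = sum f F"
  shows "homogeneous_parts (hcomp B) x f"
proof -
  have sub: "{n. f n \<noteq> 0} \<subseteq> F" using assms(3) by blast
  have "sum f F = (\<Sum>n | f n \<noteq> 0. f n)"
    by (rule sum.mono_neutral_right[OF assms(2) sub]) simp
  with assms(1,4) finite_subset[OF sub assms(2)] show ?thesis
    by (simp add: homogeneous_parts_def)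
qed

lemma homogeneous_sum:
  assumes "x \<in> car B"
  obtains F where "finite F" "\<And>n. n \<notin> F \<Longrightarrow> hpart B n x = 0" "(\<Sum>n\<in>F. hpart B n x) = x"
proof (rule that)
  show "finite {n. hpart B n x \<noteq> 0}" "(\<Sum>n | hpart B n x \<noteq> 0. hpart B n x) = x"
    using homogeneous_parts_hpart[OF assms] by (simp_all add: homogeneous_parts_def)
qed simp

lemma hpart_same: "x \<in> hcomp B n \<Longrightarrow> hpart B m x = (if m = n then x else 0)"
  by (rule hpartI[OF hcomp_in], assumption, rule homogeneous_partsI[where F = "{n}"])
     (auto simp: subspace_0 hcomp_subspace)

lemma lin_hpart: "lin B B (hpart B n)"
  unfolding lin_def
proof (intro conjI ballI allI)
  fix x assume x: "x \<in> car B"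
  obtain F where F: "finite F" "\<And>n. n \<notin> F \<Longrightarrow> hpart B n x = 0" "(\<Sum>n\<in>F. hpart B n x) = x"
    using homogeneous_sum[OF x] by blast
  show "hpart B n x \<in> car B" using hpart_hcomp[OF x] hcomp_in by blast
  show "hpart B n (scl B k x) = scl B k (hpart B n x)" for k
  proof (rule hpartI[OF vspace_closed(2)[OF vspace x]])
    show "homogeneous_parts (hcomp B) (scl B k x) (\<lambda>n. scl B k (hpart B n x))"
      using F(2) arg_cong[OF F(3)[symmetric], of "scl B k"]
      by (intro homogeneous_partsI[OF _ F(1)])
         (simp_all add: subspace_scale hcomp_subspace hpart_hcomp[OF x] scale_sum_right)
  qed
  fix y assume y: "y \<in> car B"
  obtain G where G: "finite G" "\<And>n. n \<notin> G \<Longrightarrow> hpart B n y = 0" "(\<Sum>n\<in>G. hpart B n y) = y"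
    using homogeneous_sum[OF y] by blast
  have FG: "(\<Sum>n\<in>F \<union> G. hpart B n x) = x" "(\<Sum>n\<in>F \<union> G. hpart B n y) = y"
    using F(3) G(3) sum.mono_neutral_right[of "F \<union> G" F "\<lambda>n. hpart B n x"]
      sum.mono_neutral_right[of "F \<union> G" G "\<lambda>n. hpart B n y"] F(1,2) G(1,2) by simp_all
  show "hpart B n (x + y) = hpart B n x + hpart B n y"
  proof (rule hpartI[OF vspace_closed(1)[OF vspace x y]])
    show "homogeneous_parts (hcomp B) (x + y) (\<lambda>n. hpart B n x + hpart B n y)"
    proof (rule homogeneous_partsI)
      show "finite (F \<union> G)" using F(1) G(1) by simp
      show "x + y = (\<Sum>n\<in>F \<union> G. hpart B n x + hpart B n y)"
        unfolding sum.distrib using FG by simp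
    qed (use F(2) G(2) x y in \<open>simp_all add: subspace_add hcomp_subspace hpart_hcomp\<close>)
  qed
qed

lemma homogeneous_into:
  assumes S: "subspace S" and "\<And>n. hcomp B n \<subseteq> S" and x: "x \<in> car B"
  shows "x \<in> S"
proof -
  obtain F where "(\<Sum>n\<in>F. hpart B n x) = x" using homogeneous_sum[OF x] by blast
  moreover have "(\<Sum>n\<in>F. hpart B n x) \<in> S"
    using assms(2) hpart_hcomp[OF x] by (intro subspace_sum[OF S]) blast
  ultimately show ?thesis by simp
qed

lemma lin_homogeneous_eq:
  assumes U: "is_vspace U" and F: "lin B U F" and G: "lin B U G"
    and eq: "\<And>n x. x \<in> hcomp B n \<Longrightarrow> F x = G x" and x: "x \<in> car B"
  shows "F x = G x"
proof -
  have "subspace {x \<in> car B. F x - G x = 0}"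
    by (rule lin_kernel_subspace[OF vspace U lin_minus[OF U F G] vspace_subspace[OF vspace] order_refl])
  moreover have "hcomp B n \<subseteq> {x \<in> car B. F x - G x = 0}" for n
    using hcomp_in eq by auto
  ultimately have "x \<in> {x \<in> car B. F x - G x = 0}"
    using x by (rule homogeneous_into)
  then show ?thesis by simp
qed

lemma lin_mult_left: "y \<in> car B \<Longrightarrow> lin B B (\<lambda>x. mult B (x \<odot> y))"
  and lin_mult_right: "x \<in> car B \<Longrightarrow> lin B B (\<lambda>y. mult B (x \<odot> y))"
  by (rule lin_comp[OF lin_ptensor_left lin_mult], assumption)
     (rule lin_comp[OF lin_ptensor_right lin_mult])

text \<open>
  The unit is homogeneous: its component \<open>e\<close> of degree \<open>0\<close> satisfies \<open>e x = x\<close> for homogeneous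
  \<open>x\<close>, by comparing degrees in \<open>1 x = x\<close>, hence for all \<open>x\<close>, and \<open>x = 1\<close> gives \<open>e = 1\<close>.
\<close>

lemma one_hcomp: "\<one> \<in> hcomp B 0"
proof -
  have e: "hpart B 0 \<one> \<in> car B" using hpart_hcomp[OF one_car] hcomp_in by blast
  have "mult B (hpart B 0 \<one> \<odot> x) = x" if x: "x \<in> hcomp B n" for x n
  proof -
    note xc = hcomp_in[OF x]
    have "hpart B n (mult B (\<one> \<odot> x)) = mult B (hpart B 0 \<one> \<odot> x)"
    proof (rule lin_homogeneous_eq[where F = "\<lambda>y. hpart B n (mult B (y \<odot> x))"
          and G = "\<lambda>y. mult B (hpart B 0 y \<odot> x)", OF vspace _ _ _ one_car])
      show "lin B B (\<lambda>y. hpart B n (mult B (y \<odot> x)))"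
        by (rule lin_comp[OF lin_mult_left[OF xc] lin_hpart])
      show "lin B B (\<lambda>y. mult B (hpart B 0 y \<odot> x))"
        by (rule lin_comp[OF lin_hpart lin_mult_left[OF xc]])
      fix i y assume y: "y \<in> hcomp B i"
      have "mult B (0 \<odot> x) = 0" by (rule lin_zero[OF vspace lin_mult_left[OF xc]])
      then show "hpart B n (mult B (y \<odot> x)) = mult B (hpart B 0 y \<odot> x)"
        using hpart_same[OF mult_hcomp[OF tens_hcomp2[OF y x]], of n] hpart_same[OF y, of 0] by simp
    qed
    then show ?thesis by (simp add: mult_one xc hpart_same[OF x])
  qed
  then have "mult B (hpart B 0 \<one> \<odot> \<one>) = \<one>"
    by (rule lin_homogeneous_eq[OF vspace lin_mult_right[OF e] lin_ident _ one_car])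
  then show ?thesis using hpart_hcomp[OF one_car, of 0] e by (simp add: mult_one)
qed


subsection \<open>The braiding and primitive elements\<close>

lemma lin_braid_l: "lin (B \<otimes> B \<otimes> B) (B \<otimes> B \<otimes> B) (braid_l B)"
  unfolding braid_l_def by (rule lin_tmap[OF lin_braid lin_id])

lemma lin_braid_r: "lin (B \<otimes> B \<otimes> B) (B \<otimes> B \<otimes> B) (braid_r B)"
  unfolding braid_r_def comp_def
  by (rule lin_comp[OF lin_comp[OF lin_tassoc lin_tmap] lin_tassoc_inv])
     (rule vspace lin_id lin_braid)+

lemma braid_in: "x \<in> car B \<Longrightarrow> y \<in> car B \<Longrightarrow> braid B (x \<odot> y) \<in> car (B \<otimes> B)"
  by (simp add: lin_in[OF lin_braid])

lemma braid_l_pure: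
  "s \<in> car (B \<otimes> B) \<Longrightarrow> z \<in> car B \<Longrightarrow>
    braid_l B (ptensor (B \<otimes> B) B s z) = ptensor (B \<otimes> B) B (braid B s) z"
  by (simp add: braid_l_def tmap_ptensor[OF lin_braid lin_id])

lemma braid_r_pure:
  "x \<in> car B \<Longrightarrow> y \<in> car B \<Longrightarrow> z \<in> car B \<Longrightarrow>
    braid_r B (ptensor (B \<otimes> B) B (x \<odot> y) z)
      = tassoc_inv B B B (ptensor B (B \<otimes> B) x (braid B (y \<odot> z)))"
  by (simp add: braid_r_def tassoc_ptensor[OF vspace] tmap_ptensor[OF lin_id lin_braid])

lemma braid_l_add: "braid_l B (s + t) = braid_l B s + braid_l B t"
  and braid_r_add: "braid_r B (s + t) = braid_r B s + braid_r B t"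
  and braid_mid_add: "braid_mid B (p + q) = braid_mid B p + braid_mid B q"
  by (simp_all add: braid_l_def braid_r_def braid_mid_def tmap_add tassoc_add tassoc_inv_add)

lemma lin_tens_one: "lin B (B \<otimes> B) (\<lambda>z. z \<odot> \<one>)"
  and lin_one_tens: "lin B (B \<otimes> B) (\<lambda>z. \<one> \<odot> z)"
  by (rule lin_ptensor_left[OF one_car], rule lin_ptensor_right[OF one_car])

text \<open>The zeros of this map are the primitive elements.\<close>

definition reduced_comult :: "'a \<Rightarrow> ('k, 'a, 'a) tensor" where
  "reduced_comult x = comult B x - x \<odot> \<one> - \<one> \<odot> x"

lemma lin_reduced_comult: "lin B (B \<otimes> B) reduced_comult"
  unfolding reduced_comult_def
  by (intro lin_minus is_vspace_tprod lin_comult lin_tens_one lin_one_tens)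

lemma tmap_reduced_comult:
  assumes "w \<in> car (B \<otimes> B)"
  shows "tmap B (B \<otimes> B) id reduced_comult w = tmap B (B \<otimes> B) id (comult B) w
      - tmap B (B \<otimes> B) id (\<lambda>z. z \<odot> \<one>) w - tmap B (B \<otimes> B) id (\<lambda>z. \<one> \<odot> z) w"
    and "tmap (B \<otimes> B) B reduced_comult id w = tmap (B \<otimes> B) B (comult B) id w
      - tmap (B \<otimes> B) B (\<lambda>z. z \<odot> \<one>) id w - tmap (B \<otimes> B) B (\<lambda>z. \<one> \<odot> z) id w"
  unfolding reduced_comult_def
  using lin_minus[OF is_vspace_tprod lin_comult lin_tens_one]
  by (simp_all add: tmap_id_minus[OF _ lin_one_tens is_vspace_tprod assms]
      tmap_id_minus[OF lin_comult lin_tens_one is_vspace_tprod assms]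
      tmap_minus_id[OF _ lin_one_tens is_vspace_tprod assms]
      tmap_minus_id[OF lin_comult lin_tens_one is_vspace_tprod assms])

lemma comult_primitive: "reduced_comult x = 0 \<Longrightarrow> comult B x = x \<odot> \<one> + \<one> \<odot> x"
  by (simp add: reduced_comult_def algebra_simps)

text \<open>
  Since \<open>c\<close> swaps \<open>1\<close> with any element, a factor \<open>1\<close> at an outer position of a threefold tensor
  can be moved to the middle by \<open>c\<close>; left in place, it only has to be rebracketed. The next
  four lemmas describe these moves. They evaluate the compatibilities of \<open>c\<close> with \<open>\<Delta>\<close> on the
  summands of \<open>\<Delta> x = x \<otimes> 1 + 1 \<otimes> x\<close>.
\<close>

lemma tassoc_tens_one:
  assumes w: "w \<in> car (B \<otimes> B)"
  shows "tassoc B B B (ptensor (B \<otimes> B) B w \<one>) = tmap B (B \<otimes> B) id (\<lambda>z. z \<odot> \<one>) w"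
proof (rule lin_tensor_eqI[where F = "\<lambda>w. tassoc B B B (ptensor (B \<otimes> B) B w \<one>)"
      and G = "\<lambda>w. tmap B (B \<otimes> B) id (\<lambda>z. z \<odot> \<one>) w", OF is_vspace_tprod _ _ _ w])
  show "lin (B \<otimes> B) (B \<otimes> (B \<otimes> B)) (\<lambda>w. tassoc B B B (ptensor (B \<otimes> B) B w \<one>))"
    by (rule lin_comp[OF lin_ptensor_left[OF one_car] lin_tassoc[OF vspace]])
  show "lin (B \<otimes> B) (B \<otimes> (B \<otimes> B)) (\<lambda>w. tmap B (B \<otimes> B) id (\<lambda>z. z \<odot> \<one>) w)"
    by (rule lin_tmap[OF lin_id lin_tens_one])
qed (simp_all add: tassoc_ptensor[OF vspace] tmap_ptensor[OF lin_id lin_tens_one] one_car)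

lemma tassoc_inv_one_tens:
  assumes w: "w \<in> car (B \<otimes> B)"
  shows "tassoc_inv B B B (ptensor B (B \<otimes> B) \<one> w) = tmap (B \<otimes> B) B (\<lambda>z. \<one> \<odot> z) id w"
proof (rule lin_tensor_eqI[where F = "\<lambda>w. tassoc_inv B B B (ptensor B (B \<otimes> B) \<one> w)"
      and G = "\<lambda>w. tmap (B \<otimes> B) B (\<lambda>z. \<one> \<odot> z) id w", OF is_vspace_tprod _ _ _ w])
  show "lin (B \<otimes> B) (B \<otimes> B \<otimes> B) (\<lambda>w. tassoc_inv B B B (ptensor B (B \<otimes> B) \<one> w))"
    by (rule lin_comp[OF lin_ptensor_right[OF one_car] lin_tassoc_inv[OF vspace]])
  show "lin (B \<otimes> B) (B \<otimes> B \<otimes> B) (\<lambda>w. tmap (B \<otimes> B) B (\<lambda>z. \<one> \<odot> z) id w)"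
    by (rule lin_tmap[OF lin_one_tens lin_id])
qed (simp_all add: tassoc_inv_ptensor[OF vspace] tmap_ptensor[OF lin_one_tens lin_id] one_car)

lemma braid_l_one_tens:
  assumes w: "w \<in> car (B \<otimes> B)"
  shows "tassoc B B B (braid_l B (tassoc_inv B B B (ptensor B (B \<otimes> B) \<one> w))) = tmap B (B \<otimes> B) id (\<lambda>z. \<one> \<odot> z) w"
proof (rule lin_tensor_eqI[where F = "\<lambda>w. tassoc B B B (braid_l B (tassoc_inv B B B (ptensor B (B \<otimes> B) \<one> w)))"
      and G = "\<lambda>w. tmap B (B \<otimes> B) id (\<lambda>z. \<one> \<odot> z) w", OF is_vspace_tprod _ _ _ w])
  show "lin (B \<otimes> B) (B \<otimes> (B \<otimes> B)) (\<lambda>w. tassoc B B B (braid_l B (tassoc_inv B B B (ptensor B (B \<otimes> B) \<one> w))))"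
    by (rule lin_comp[OF lin_comp[OF lin_comp[OF lin_ptensor_right[OF one_car] lin_tassoc_inv[OF vspace]]
            lin_braid_l] lin_tassoc[OF vspace]])
  show "lin (B \<otimes> B) (B \<otimes> (B \<otimes> B)) (\<lambda>w. tmap B (B \<otimes> B) id (\<lambda>z. \<one> \<odot> z) w)"
    by (rule lin_tmap[OF lin_id lin_one_tens])
qed (simp_all add: tassoc_ptensor[OF vspace] tassoc_inv_ptensor[OF vspace] braid_l_pure braid_one
    tmap_ptensor[OF lin_id lin_one_tens] one_car)

lemma braid_r_tens_one:
  assumes w: "w \<in> car (B \<otimes> B)"
  shows "braid_r B (ptensor (B \<otimes> B) B w \<one>) = tmap (B \<otimes> B) B (\<lambda>z. z \<odot> \<one>) id w"
proof (rule lin_tensor_eqI[where F = "\<lambda>w. braid_r B (ptensor (B \<otimes> B) B w \<one>)"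
      and G = "\<lambda>w. tmap (B \<otimes> B) B (\<lambda>z. z \<odot> \<one>) id w", OF is_vspace_tprod _ _ _ w])
  show "lin (B \<otimes> B) (B \<otimes> B \<otimes> B) (\<lambda>w. braid_r B (ptensor (B \<otimes> B) B w \<one>))"
    by (rule lin_comp[OF lin_ptensor_left[OF one_car] lin_braid_r])
  show "lin (B \<otimes> B) (B \<otimes> B \<otimes> B) (\<lambda>w. tmap (B \<otimes> B) B (\<lambda>z. z \<odot> \<one>) id w)"
    by (rule lin_tmap[OF lin_tens_one lin_id])
qed (simp_all add: braid_r_pure tassoc_inv_ptensor[OF vspace] braid_one
    tmap_ptensor[OF lin_tens_one lin_id] one_car)

lemma tens_left_add: "a \<in> car (B \<otimes> B) \<Longrightarrow> b \<in> car (B \<otimes> B) \<Longrightarrow> y \<in> car B \<Longrightarrow>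
    ptensor (B \<otimes> B) B (a + b) y = ptensor (B \<otimes> B) B a y + ptensor (B \<otimes> B) B b y"
  and tens_right_add: "a \<in> car (B \<otimes> B) \<Longrightarrow> b \<in> car (B \<otimes> B) \<Longrightarrow> y \<in> car B \<Longrightarrow>
    ptensor B (B \<otimes> B) y (a + b) = ptensor B (B \<otimes> B) y a + ptensor B (B \<otimes> B) y b"
  using lin_add[OF lin_ptensor_left[of y B "B \<otimes> B"]] lin_add[OF lin_ptensor_right[of y B "B \<otimes> B"]]
  by simp_all

text \<open>Reduces the degree bookkeeping for \<open>c (x \<otimes> y)\<close> to homogeneous second or first arguments.\<close>

lemma braid_decompose:
  assumes x: "x \<in> car B" and y: "y \<in> car B"
    and S: "tensor.subspace S"
  shows "(\<And>n z. z \<in> hcomp B n \<Longrightarrow> braid B (x \<odot> z) \<in> S) \<Longrightarrow> braid B (x \<odot> y) \<in> S"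
    and "(\<And>n z. z \<in> hcomp B n \<Longrightarrow> braid B (z \<odot> y) \<in> S) \<Longrightarrow> braid B (x \<odot> y) \<in> S"
proof -
  have *: "subspace {z \<in> car B. F z \<in> S}" if F: "lin B (B \<otimes> B) F" for F
    using vspace_closed[OF vspace] vspace_0[OF vspace] lin_zero[OF vspace F] lin_add[OF F]
      lin_scale[OF F] tensor.subspace_0[OF S] tensor.subspace_add[OF S] tensor.subspace_scale[OF S]
    unfolding subspace_def by simp
  show "braid B (x \<odot> y) \<in> S" if "\<And>n z. z \<in> hcomp B n \<Longrightarrow> braid B (x \<odot> z) \<in> S"
    using homogeneous_into[OF *[OF lin_comp[OF lin_ptensor_right[OF x] lin_braid]] _ y] that hcomp_in
    by blast
  show "braid B (x \<odot> y) \<in> S" if "\<And>n z. z \<in> hcomp B n \<Longrightarrow> braid B (z \<odot> y) \<in> S"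
    using homogeneous_into[OF *[OF lin_comp[OF lin_ptensor_left[OF y] lin_braid]] _ x] that hcomp_in
    by blast
qed

text \<open>
  The braiding carries primitive elements of degree \<open>n\<close> to primitive elements of degree \<open>n\<close>:
  \<open>(B \<otimes> \<Delta>) c\<close> is expressed through \<open>\<Delta> \<otimes> B\<close>, so \<open>B \<otimes> reduced_comult\<close> kills \<open>c (x \<otimes> y)\<close> for
  primitive \<open>x\<close>, and kernels commute with \<open>B \<otimes> _\<close>.
\<close>

lemma braid_primitive_left:
  assumes x: "x \<in> hcomp B n" and prim: "reduced_comult x = 0" and y: "y \<in> car B"
  shows "braid B (x \<odot> y) \<in> subtensor B B (car B) {z \<in> hcomp B n. reduced_comult z = 0}"
proof (rule tmap_kernel_right[OF vspace is_vspace_tprod lin_reduced_comult hcomp_subspace hcomp_car])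
  note xc = hcomp_in[OF x]
  let ?w = "braid B (x \<odot> y)"
  have w: "?w \<in> car (B \<otimes> B)" by (rule braid_in[OF xc y])
  show "?w \<in> subtensor B B (car B) (hcomp B n)"
  proof (rule braid_decompose(1)[OF xc y subtensor_subspace])
    fix m z assume "z \<in> hcomp B m"
    from braid_hcomp[OF tens_hcomp2[OF x this]]
    show "braid B (x \<odot> z) \<in> subtensor B B (car B) (hcomp B n)"
      unfolding hcomp2_def using subtensor_mono[OF hcomp_car order_refl] by blast
  qed
  have "tmap B (B \<otimes> B) id (comult B) ?w
      = tassoc B B B (braid_l B (braid_r B (ptensor (B \<otimes> B) B (x \<odot> \<one> + \<one> \<odot> x) y)))"
    using comult_braid_right[of "x \<odot> y"]
    by (simp add: xc y tmap_ptensor[OF lin_comult lin_id] comult_primitive[OF prim])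
  also have "\<dots> = tassoc B B B (ptensor (B \<otimes> B) B ?w \<one>)
      + tassoc B B B (braid_l B (tassoc_inv B B B (ptensor B (B \<otimes> B) \<one> ?w)))"
    by (simp add: xc y one_car tens_left_add braid_r_add braid_l_add tassoc_add braid_r_pure
        braid_one tassoc_inv_ptensor[OF vspace] braid_l_pure)
  also have "\<dots> = tmap B (B \<otimes> B) id (\<lambda>z. z \<odot> \<one>) ?w + tmap B (B \<otimes> B) id (\<lambda>z. \<one> \<odot> z) ?w"
    by (simp add: tassoc_tens_one[OF w] braid_l_one_tens[OF w])
  finally show "tmap B (B \<otimes> B) id reduced_comult ?w = 0"
    by (simp add: tmap_reduced_comult[OF w])
qed

text \<open>The same with \<open>(\<Delta> \<otimes> B) c\<close>, which is expressed through \<open>B \<otimes> \<Delta>\<close>.\<close>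

lemma braid_primitive_right:
  assumes x: "x \<in> car B" and y: "y \<in> hcomp B n" and prim: "reduced_comult y = 0"
  shows "braid B (x \<odot> y) \<in> subtensor B B {z \<in> hcomp B n. reduced_comult z = 0} (car B)"
proof (rule tmap_kernel_left[OF vspace is_vspace_tprod lin_reduced_comult hcomp_subspace hcomp_car])
  note yc = hcomp_in[OF y]
  let ?w = "braid B (x \<odot> y)"
  have w: "?w \<in> car (B \<otimes> B)" by (rule braid_in[OF x yc])
  show "?w \<in> subtensor B B (hcomp B n) (car B)"
  proof (rule braid_decompose(2)[OF x yc subtensor_subspace])
    fix m z assume "z \<in> hcomp B m"
    from braid_hcomp[OF tens_hcomp2[OF this y]]
    show "braid B (z \<odot> y) \<in> subtensor B B (hcomp B n) (car B)"
      unfolding hcomp2_def using subtensor_mono[OF order_refl hcomp_car] by blast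
  qed
  have "tmap (B \<otimes> B) B (comult B) id ?w
      = braid_r B (braid_l B (tassoc_inv B B B (ptensor B (B \<otimes> B) x (y \<odot> \<one> + \<one> \<odot> y))))"
    using comult_braid_left[of "x \<odot> y"]
    by (simp add: x yc tmap_ptensor[OF lin_id lin_comult] comult_primitive[OF prim])
  also have "\<dots> = braid_r B (ptensor (B \<otimes> B) B ?w \<one>)
      + tassoc_inv B B B (ptensor B (B \<otimes> B) \<one> ?w)"
    by (simp add: x yc one_car tens_right_add braid_r_add braid_l_add tassoc_inv_add braid_r_pure
        braid_one tassoc_inv_ptensor[OF vspace] braid_l_pure)
  also have "\<dots> = tmap (B \<otimes> B) B (\<lambda>z. z \<odot> \<one>) id ?w + tmap (B \<otimes> B) B (\<lambda>z. \<one> \<odot> z) id ?w"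
    by (simp add: braid_r_tens_one[OF w] tassoc_inv_one_tens[OF w])
  finally show "tmap (B \<otimes> B) B reduced_comult id ?w = 0"
    by (simp add: tmap_reduced_comult[OF w])
qed

text \<open>
  In \<open>\<Delta> (x y) = (x \<otimes> 1 + 1 \<otimes> x) (y \<otimes> 1 + 1 \<otimes> y)\<close>, multiplied out in the braided tensor square,
  the two mixed products are \<open>x \<otimes> y\<close> and \<open>c (x \<otimes> y)\<close>.
\<close>

lemma reduced_comult_mult:
  assumes x: "x \<in> car B" "reduced_comult x = 0" and y: "y \<in> car B" "reduced_comult y = 0"
  shows "reduced_comult (mult B (x \<odot> y)) = x \<odot> y + braid B (x \<odot> y)"
proof -
  \<comment> \<open>\<open>G a s d\<close> multiplies \<open>a\<close> and \<open>d\<close> onto the outer sides of the braided middle factors \<open>s\<close>\<close>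
  define G where "G a s d = tmap B B (mult B) (mult B)
    (tassoc_inv B B (B \<otimes> B) (ptensor B (B \<otimes> (B \<otimes> B)) a (tassoc B B B (ptensor (B \<otimes> B) B s d))))"
    for a s d
  have G_pure: "G a (p \<odot> q) d = mult B (a \<odot> p) \<odot> mult B (q \<odot> d)"
    if "a \<in> car B" "p \<in> car B" "q \<in> car B" "d \<in> car B" for a p q d
    using that by (simp add: G_def tassoc_ptensor[OF vspace] tassoc_inv_ptensor[OF vspace]
        tmap_ptensor[OF lin_mult lin_mult])
  have lin_G: "lin (B \<otimes> B) (B \<otimes> B) (\<lambda>s. G \<one> s \<one>)"
    unfolding G_def
    by (intro lin_comp[OF lin_comp[OF lin_comp[OF lin_comp[OF lin_ptensor_left[OF one_car]
            lin_tassoc[OF vspace]] lin_ptensor_right[OF one_car]] lin_tassoc_inv[OF vspace]]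
          lin_tmap[OF lin_mult lin_mult]])
  have G_one: "G \<one> s \<one> = s" if "s \<in> car (B \<otimes> B)" for s
    by (rule lin_tensor_eqI[where G = "\<lambda>s. s", OF is_vspace_tprod lin_G lin_ident _ that])
       (simp_all add: G_pure one_car mult_one)
  have lin_mid: "lin (B \<otimes> (B \<otimes> B)) (B \<otimes> (B \<otimes> B)) (tassoc B B B \<circ> braid_l B \<circ> tassoc_inv B B B)"
    unfolding comp_def
    by (rule lin_comp[OF lin_comp[OF lin_tassoc_inv[OF vspace] lin_braid_l] lin_tassoc[OF vspace]])
  have mid: "tmap B B (mult B) (mult B) (braid_mid B (ptensor (B \<otimes> B) (B \<otimes> B) (a \<odot> b) (c \<odot> d)))
      = G a (braid B (b \<odot> c)) d"
    if "a \<in> car B" "b \<in> car B" "c \<in> car B" "d \<in> car B" for a b c d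
    using that
    by (simp add: braid_mid_def G_def tassoc_ptensor[OF is_vspace_tprod] tassoc_inv_ptensor[OF vspace]
        tmap_ptensor[OF lin_id lin_mid] braid_l_pure ptensor_in)
  have add: "ptensor (B \<otimes> B) (B \<otimes> B) (a + b) (c + d)
      = ptensor (B \<otimes> B) (B \<otimes> B) a c + ptensor (B \<otimes> B) (B \<otimes> B) a d
        + (ptensor (B \<otimes> B) (B \<otimes> B) b c + ptensor (B \<otimes> B) (B \<otimes> B) b d)"
    if "a \<in> car (B \<otimes> B)" "b \<in> car (B \<otimes> B)" "c \<in> car (B \<otimes> B)" "d \<in> car (B \<otimes> B)" for a b c d
    using that vspace_closed(1)[OF is_vspace_tprod that(3,4)]
    by (simp add: lin_add[OF lin_ptensor_left] lin_add[OF lin_ptensor_right])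
  have "comult B (mult B (x \<odot> y)) = tmap B B (mult B) (mult B) (braid_mid B
      (ptensor (B \<otimes> B) (B \<otimes> B) (x \<odot> \<one> + \<one> \<odot> x) (y \<odot> \<one> + \<one> \<odot> y)))"
    using x y
    by (simp add: comult_mult tmap_ptensor[OF lin_comult lin_comult] comult_primitive)
  also have "\<dots> = G x (y \<odot> \<one>) \<one> + G x (\<one> \<odot> \<one>) y + (G \<one> (braid B (x \<odot> y)) \<one> + G \<one> (\<one> \<odot> x) y)"
    using x y one_car by (simp add: add braid_mid_add tmap_add mid braid_one)
  also have "\<dots> = mult B (x \<odot> y) \<odot> \<one> + x \<odot> y + (braid B (x \<odot> y) + \<one> \<odot> mult B (x \<odot> y))"
    using x y one_car by (simp add: G_pure G_one braid_in mult_one)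
  finally show ?thesis by (simp add: reduced_comult_def)
qed

text \<open>
  As \<open>1\<close> has degree \<open>0\<close>, the comultiplication of a primitive element has no inner components,
  that is, none in \<open>B\<^sup>a \<otimes> B\<^sup>b\<close> with \<open>a\<close> and \<open>b\<close> positive.
\<close>

lemma primitive_E_comp:
  assumes x: "x \<in> hcomp B n" and prim: "reduced_comult x = 0"
  shows "x \<in> E_comp B n"
proof -
  have "comult_comp B a b x = 0" if "1 \<le> a" "1 \<le> b" for a b
  proof -
    have "comult_comp B a b x = hpart B a x \<odot> 0 + 0 \<odot> hpart B b x"
      using that hcomp_in[OF x] one_car
      by (simp add: comult_comp_def comult_primitive[OF prim] tmap_add
          tmap_ptensor[OF lin_hpart lin_hpart] hpart_same[OF one_hcomp])
    also have "\<dots> = 0"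
      using lin_zero[OF vspace lin_ptensor_right[of "hpart B a x" B B]]
        lin_zero[OF vspace lin_ptensor_left[of "hpart B b x" B B]]
        lin_in[OF lin_hpart hcomp_in[OF x], of a] lin_in[OF lin_hpart hcomp_in[OF x], of b] by simp
    finally show ?thesis .
  qed
  with x show ?thesis by (simp add: E_comp_def)
qed

end


subsection \<open>Zero-connected bialgebras\<close>

locale connected_braided_bialg = graded_braided_bialg B
  for B :: "('k::field, 'a::ab_group_add) bialg" +
  assumes connected: "zero_connected B"
begin

lemma hcomp_zero:
  assumes u: "u \<in> hcomp B 0"
  shows "\<exists>k. u = scl B k \<one>"
proof -
  obtain Q where Q: "hcomp B 0 \<subseteq> span Q" "card Q = dim (hcomp B 0)"
    using basis_exists[of "hcomp B 0"] by blast
  then obtain b where "Q = {b}"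
    using connected card_1_singletonE unfolding zero_connected_def by metis
  then have "\<one> \<in> span {b}" "u \<in> span {b}" using Q u one_hcomp by auto
  then obtain k l where k: "\<one> = scl B k b" and l: "u = scl B l b"
    by (auto simp: span_singleton)
  have "\<one> \<noteq> 0" using counit_one lin_zero[OF vspace lin_counit] by auto
  then have "k \<noteq> 0" using k by auto
  then have "u = scl B (l / k) \<one>" by (simp add: k l)
  then show ?thesis ..
qed

text \<open>
  Since \<open>B\<^sup>0 = K 1\<close>, the components of \<open>\<Delta> x\<close> in \<open>B\<^sup>0 \<otimes> B\<^sup>n\<close> and \<open>B\<^sup>n \<otimes> B\<^sup>0\<close> have the form \<open>1 \<otimes> z\<close>
  and \<open>z' \<otimes> 1\<close>; everything else lies in the inner components.
\<close>

lemma comult_shape: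
  assumes n: "1 \<le> n" and x: "x \<in> hcomp B n"
  obtains z z' m where "z \<in> hcomp B n" "z' \<in> hcomp B n"
    "m \<in> tensor.span (\<Union>{hcomp2 B a b | a b. 1 \<le> a \<and> 1 \<le> b \<and> a + b = n})"
    "comult B x = \<one> \<odot> z + z' \<odot> \<one> + m"
proof -
  define M where "M = tensor.span (\<Union>{hcomp2 B a b | a b. 1 \<le> a \<and> 1 \<le> b \<and> a + b = n})"
  define L where "L = subtensor B B {\<one>} (hcomp B n)"
  define R where "R = subtensor B B (hcomp B n) {\<one>}"
  have one_sub: "{\<one>} \<subseteq> car B" using one_car by simp
  have sub: "tensor.subspace {a + b | a b. a \<in> {a + b | a b. a \<in> L \<and> b \<in> R} \<and> b \<in> M}"
    unfolding L_def R_def M_def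
    by (intro tensor.subspace_sums tensor.subspace_span subtensor_subspace)
  have in_sub: "w \<in> {a + b | a b. a \<in> {a + b | a b. a \<in> L \<and> b \<in> R} \<and> b \<in> M}"
    if w: "w \<in> L \<or> w \<in> R \<or> w \<in> M" for w
  proof -
    have 0: "0 \<in> L" "0 \<in> R" "0 \<in> M"
      unfolding L_def R_def M_def by (simp_all add: tensor.subspace_0 subtensor_subspace tensor.span_zero)
    consider "w \<in> L" | "w \<in> R" | "w \<in> M" using w by blast
    then show ?thesis
    proof cases
      case 1
      then have "w = (w + 0) + 0" by simp
      with 1 0 show ?thesis by blast
    next
      case 2
      then have "w = (0 + w) + 0" by simp
      with 2 0 show ?thesis by blast
    next
      case 3
      then have "w = (0 + 0) + w" by simp
      with 3 0 show ?thesis by blast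
    qed
  qed
  have scale_left: "u \<odot> y \<in> L" if "u \<in> hcomp B 0" "y \<in> hcomp B n" for u y
  proof -
    obtain k where "u = scl B k \<one>" using hcomp_zero \<open>u \<in> hcomp B 0\<close> by blast
    then have "u \<odot> y = tscl k (\<one> \<odot> y)"
      using lin_scale[OF lin_ptensor_left[OF hcomp_in[OF that(2)]] one_car, of k] by simp
    moreover have "\<one> \<odot> y \<in> L" unfolding L_def using that by (simp add: ptensor_subtensor)
    ultimately show ?thesis
      unfolding L_def by (simp add: tensor.subspace_scale subtensor_subspace)
  qed
  have scale_right: "y \<odot> u \<in> R" if "u \<in> hcomp B 0" "y \<in> hcomp B n" for u y
  proof -
    obtain k where "u = scl B k \<one>" using hcomp_zero \<open>u \<in> hcomp B 0\<close> by blast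
    then have "y \<odot> u = tscl k (y \<odot> \<one>)"
      using lin_scale[OF lin_ptensor_right[OF hcomp_in[OF that(2)]] one_car, of k] by simp
    moreover have "y \<odot> \<one> \<in> R" unfolding R_def using that by (simp add: ptensor_subtensor)
    ultimately show ?thesis
      unfolding R_def by (simp add: tensor.subspace_scale subtensor_subspace)
  qed
  have L: "hcomp2 B 0 n \<subseteq> L"
    unfolding hcomp2_def subtensor_def
    by (rule tensor.span_minimal) (use scale_left L_def subtensor_subspace in auto)
  have R: "hcomp2 B n 0 \<subseteq> R"
    unfolding hcomp2_def subtensor_def
    by (rule tensor.span_minimal) (use scale_right R_def subtensor_subspace in auto)
  have "comult B x \<in> {a + b | a b. a \<in> {a + b | a b. a \<in> L \<and> b \<in> R} \<and> b \<in> M}"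
  proof (rule subsetD[OF tensor.span_minimal[OF _ sub] comult_hcomp[OF x]], rule Union_least)
    fix X assume "X \<in> {hcomp2 B a b | a b. a + b = n}"
    then obtain a b where X: "X = hcomp2 B a b" "a + b = n" by blast
    have "X \<subseteq> L \<or> X \<subseteq> R \<or> X \<subseteq> M"
    proof (cases "a = 0 \<or> b = 0")
      case True
      then show ?thesis using X L R by auto
    next
      case False
      then have "X \<subseteq> \<Union>{hcomp2 B a b | a b. 1 \<le> a \<and> 1 \<le> b \<and> a + b = n}"
        using X by (intro Union_upper) (auto simp: Suc_le_eq)
      then show ?thesis unfolding M_def using tensor.span_superset by blast
    qed
    then show "X \<subseteq> {a + b | a b. a \<in> {a + b | a b. a \<in> L \<and> b \<in> R} \<and> b \<in> M}"
      using in_sub by blast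
  qed
  then obtain l r m where lrm: "l \<in> L" "r \<in> R" "m \<in> M" "comult B x = l + r + m" by blast
  have "l \<in> (\<lambda>z. \<one> \<odot> z) ` hcomp B n"
    using lrm(1) unfolding L_def
  proof (rule lin_tensor_into[OF is_vspace_tprod lin_ident one_sub hcomp_car, rotated 2])
    show "module.subspace (scl (B \<otimes> B)) ((\<lambda>z. \<one> \<odot> z) ` hcomp B n)"
      using lin_image_subspace[OF lin_one_tens vspace is_vspace_tprod hcomp_subspace hcomp_car] by simp
  qed auto
  moreover have "r \<in> (\<lambda>z. z \<odot> \<one>) ` hcomp B n"
    using lrm(2) unfolding R_def
  proof (rule lin_tensor_into[OF is_vspace_tprod lin_ident hcomp_car one_sub, rotated 2])
    show "module.subspace (scl (B \<otimes> B)) ((\<lambda>z. z \<odot> \<one>) ` hcomp B n)"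
      using lin_image_subspace[OF lin_tens_one vspace is_vspace_tprod hcomp_subspace hcomp_car] by simp
  qed auto
  ultimately show ?thesis using that lrm(3,4) unfolding M_def by blast
qed

text \<open>
  If the inner components of \<open>\<Delta> x\<close> vanish, then \<open>\<Delta> x = 1 \<otimes> z + z' \<otimes> 1\<close>, and \<open>z = x = z'\<close> by the
  counit axioms, because the counit vanishes in positive degree. With \<open>primitive_E_comp\<close>, the
  space \<open>E\<^sub>n\<close> consists of the primitive elements of degree \<open>n\<close>.
\<close>

lemma E_comp_primitive:
  assumes n: "1 \<le> n" and x: "x \<in> E_comp B n"
  shows "reduced_comult x = 0"
proof -
  have xn: "x \<in> hcomp B n" using x by (simp add: E_comp_def)
  note xc = hcomp_in[OF xn]
  obtain z z' m where z: "z \<in> hcomp B n" "z' \<in> hcomp B n"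
    and m: "m \<in> tensor.span (\<Union>{hcomp2 B a b | a b. 1 \<le> a \<and> 1 \<le> b \<and> a + b = n})"
    and eq: "comult B x = \<one> \<odot> z + z' \<odot> \<one> + m"
    using comult_shape[OF n xn] by blast
  note zc = hcomp_in[OF z(1)] hcomp_in[OF z(2)]
  have tens_0: "y \<odot> 0 = 0" "0 \<odot> y = 0" if "y \<in> car B" for y
    using lin_zero[OF vspace lin_ptensor_right[OF that]] lin_zero[OF vspace lin_ptensor_left[OF that]]
    by simp_all
  \<comment> \<open>the projection onto the inner components of degree \<open>n\<close>\<close>
  define P where "P w = (\<Sum>a\<in>{1..<n}. tmap B B (hpart B a) (hpart B (n - a)) w)" for w
  have P_add: "P (v + w) = P v + P w" for v w
    by (simp only: P_def tmap_add sum.distrib)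
  have P_scale: "P (tscl k w) = tscl k (P w)" for k w
    by (simp only: P_def tmap_scale tensor.scale_sum_right)
  have P_pure: "P (u \<odot> v) = (if 1 \<le> a \<and> 1 \<le> b then u \<odot> v else 0)"
    if "u \<in> hcomp B a" "v \<in> hcomp B b" "a + b = n" for a b u v
  proof -
    have "tmap B B (hpart B i) (hpart B (n - i)) (u \<odot> v) = (if i = a then u \<odot> v else 0)" for i
      using that(3) hcomp_in[OF that(1)] hcomp_in[OF that(2)]
      by (simp add: tmap_ptensor[OF lin_hpart lin_hpart] hpart_same[OF that(1)] hpart_same[OF that(2)]
          tens_0 vspace_0[OF vspace])
         (use that in auto)
    then have "P (u \<odot> v) = (if a \<in> {1..<n} then u \<odot> v else 0)"
      unfolding P_def by (simp only: sum.delta finite_atLeastLessThan)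
    then show ?thesis using that(3) by auto
  qed
  have "P m = m"
  proof -
    have "tensor.subspace {w. P w = w}"
      unfolding tensor.subspace_def using P_add P_scale P_scale[of 0 0] by simp
    moreover have "X \<subseteq> {w. P w = w}"
      if X: "X \<in> {hcomp2 B a b | a b. 1 \<le> a \<and> 1 \<le> b \<and> a + b = n}" for X
    proof -
      obtain a b where ab: "X = hcomp2 B a b" "1 \<le> a" "1 \<le> b" "a + b = n" using X by blast
      show ?thesis
        unfolding ab(1) hcomp2_def subtensor_def
        by (rule tensor.span_minimal) (use P_pure ab \<open>tensor.subspace {w. P w = w}\<close> in auto)
    qed
    ultimately have "m \<in> {w. P w = w}"
      using m by (meson Union_least subsetD tensor.span_minimal)
    then show ?thesis by simp
  qed
  moreover have "P (\<one> \<odot> z) = 0" "P (z' \<odot> \<one>) = 0"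
    using P_pure[OF one_hcomp z(1)] P_pure[OF z(2) one_hcomp] by simp_all
  moreover have "P (comult B x) = 0"
  proof -
    have "tmap B B (hpart B a) (hpart B (n - a)) (comult B x) = 0" if "a \<in> {1..<n}" for a
      using x that by (auto simp: E_comp_def comult_comp_def)
    then show ?thesis unfolding P_def by (rule sum.neutral[OF ballI])
  qed
  ultimately have "m = 0" using P_add eq by simp
  with eq have eq': "comult B x = \<one> \<odot> z + z' \<odot> \<one>" by simp
  have "ptensor ground B 1 x = ptensor ground B 1 z + ptensor ground B (counit B z') \<one>"
    using counit_left[OF xc] zc one_car
    by (simp add: eq' tmap_add tmap_ptensor[OF lin_counit lin_id] counit_one)
  also have "ptensor ground B (counit B z') \<one> = 0"
    using n lin_zero[OF _ lin_ptensor_left[OF one_car, of ground]] counit_hcomp[OF _ z(2)]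
    by (simp add: ground_def is_vspace_def vector_space_ground module.subspace_UNIV
        module_iff_vector_space)
  finally have "x = z"
    using ptensor_ground_cancel_left[OF vspace xc zc(1)] by simp
  have "ptensor B ground x 1 = ptensor B ground \<one> (counit B z) + ptensor B ground z' 1"
    using counit_right[OF xc] zc one_car
    by (simp add: eq' tmap_add tmap_ptensor[OF lin_id lin_counit] counit_one)
  also have "ptensor B ground \<one> (counit B z) = 0"
    using n lin_zero[OF _ lin_ptensor_right[OF one_car, of ground]] counit_hcomp[OF _ z(1)]
    by (simp add: ground_def is_vspace_def vector_space_ground module.subspace_UNIV
        module_iff_vector_space)
  finally have "x = z'"
    using ptensor_ground_cancel_right[OF vspace xc zc(2)] by simp
  with \<open>x = z\<close> eq' show ?thesis by (simp add: reduced_comult_def)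
qed

text \<open>There are no inner components in degree \<open>1\<close>.\<close>

lemma hcomp1_primitive: "x \<in> hcomp B 1 \<Longrightarrow> reduced_comult x = 0"
  by (rule E_comp_primitive[of 1]) (auto simp: E_comp_def)

lemma reduced_comult_mult_hcomp2:
  assumes t: "t \<in> hcomp2 B 1 1"
  shows "reduced_comult (mult B t) = t + braid B t"
proof (rule lin_tensor_eq[where F = "\<lambda>t. reduced_comult (mult B t)" and G = "\<lambda>t. t + braid B t",
      OF is_vspace_tprod _ _ hcomp_car hcomp_car _ t[unfolded hcomp2_def]])
  show "lin (B \<otimes> B) (B \<otimes> B) (\<lambda>t. reduced_comult (mult B t))"
    by (rule lin_comp[OF lin_mult lin_reduced_comult])
  show "lin (B \<otimes> B) (B \<otimes> B) (\<lambda>t. t + braid B t)"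
    by (rule lin_plus[OF is_vspace_tprod lin_ident lin_braid])
qed (simp add: reduced_comult_mult hcomp_in hcomp1_primitive)


subsection \<open>The ideal generated by the primitive elements\<close>

lemma E_comp_car: "E_comp B n \<subseteq> car B"
  using hcomp_car by (auto simp: E_comp_def)

lemma E_space_car: "E_space B \<subseteq> car B"
  unfolding E_space_def
  using E_comp_car by (intro span_minimal vspace_subspace[OF vspace]) blast

abbreviation prim_ideal :: "'a set" where
  "prim_ideal \<equiv> ideal_gen B (E_space B)"

lemma E_comp_ideal: "2 \<le> n \<Longrightarrow> E_comp B n \<subseteq> prim_ideal"
  unfolding ideal_gen_def E_space_def using span_superset[of "\<Union>n\<in>{2..}. E_comp B n"] by blast

lemma prim_ideal_minimal: "two_sided_ideal B J \<Longrightarrow> (\<And>n. 2 \<le> n \<Longrightarrow> E_comp B n \<subseteq> J) \<Longrightarrow> prim_ideal \<subseteq> J"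
proof -
  assume J: "two_sided_ideal B J" "\<And>n. 2 \<le> n \<Longrightarrow> E_comp B n \<subseteq> J"
  then have "E_space B \<subseteq> J"
    unfolding E_space_def by (intro span_minimal) (auto simp: two_sided_ideal_def)
  with J(1) show "prim_ideal \<subseteq> J" unfolding ideal_gen_def by blast
qed

lemma two_sided_prim_ideal: "two_sided_ideal B prim_ideal"
proof -
  have car: "two_sided_ideal B (car B)"
    using vspace_subspace[OF vspace] mult_in by (simp add: two_sided_ideal_def)
  then have sub: "prim_ideal \<subseteq> car B"
    using E_space_car unfolding ideal_gen_def by blast
  have "subspace prim_ideal"
    unfolding ideal_gen_def by (rule subspace_Inter) (auto simp: two_sided_ideal_def)
  with sub show ?thesis
    unfolding two_sided_ideal_def by (auto simp: ideal_gen_def two_sided_ideal_def)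
qed

lemma prim_ideal_subspace: "subspace prim_ideal"
  and prim_ideal_car: "prim_ideal \<subseteq> car B"
  and prim_ideal_mult: "x \<in> car B \<Longrightarrow> y \<in> prim_ideal \<Longrightarrow> mult B (x \<odot> y) \<in> prim_ideal"
    "x \<in> car B \<Longrightarrow> y \<in> prim_ideal \<Longrightarrow> mult B (y \<odot> x) \<in> prim_ideal"
  using two_sided_prim_ideal by (auto simp: two_sided_ideal_def)

lemma lin_preimage_subspace:
  assumes F: "\<And>y. y \<in> car B \<Longrightarrow> lin B (B \<otimes> B) (F y)" and T: "tensor.subspace T"
  shows "subspace {x \<in> car B. \<forall>y\<in>car B. F y x \<in> T}"
  using vspace_closed[OF vspace] vspace_0[OF vspace] tensor.subspace_0[OF T] tensor.subspace_add[OF T]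
    tensor.subspace_scale[OF T] lin_zero[OF vspace F] lin_add[OF F] lin_scale[OF F]
  unfolding subspace_def by simp

text \<open>
  The ideal \<open>I\<close> is compatible with the braiding, \<open>c (I \<otimes> B) \<subseteq> B \<otimes> I\<close>, because the elements \<open>x\<close>
  with \<open>c (x \<otimes> B) \<subseteq> B \<otimes> I\<close> form an ideal by \<open>c (m \<otimes> B) = (B \<otimes> m) (c \<otimes> B) (B \<otimes> c)\<close>, and this ideal
  contains the generators: \<open>c\<close> moves primitive elements past \<open>B\<close> as primitive elements.
\<close>

lemma braid_prim_ideal_left:
  assumes x: "x \<in> prim_ideal" and y: "y \<in> car B"
  shows "braid B (x \<odot> y) \<in> subtensor B B (car B) prim_ideal"
proof -
  define T where "T = subtensor B B (car B) prim_ideal"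
  have T: "tensor.subspace T" unfolding T_def by (rule subtensor_subspace)
  define J where "J = {x \<in> car B. \<forall>y\<in>car B. braid B (x \<odot> y) \<in> T}"
  \<comment> \<open>\<open>\<Psi>\<close> is \<open>B \<otimes> m\<close>; with the braiding applied first, it is the last part of \<open>c (m \<otimes> B)\<close>\<close>
  define \<Psi> where "\<Psi> s z = tmap B B id (mult B) (tassoc B B B (ptensor (B \<otimes> B) B s z))" for s z
  have lin_\<Psi>: "lin (B \<otimes> B) (B \<otimes> B) (\<lambda>s. \<Psi> s z)" if "z \<in> car B" for z
    unfolding \<Psi>_def
    by (rule lin_comp[OF lin_comp[OF lin_ptensor_left[OF that] lin_tassoc[OF vspace]]
          lin_tmap[OF lin_id lin_mult]])
  have \<Psi>: "\<Psi> s z \<in> T"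
    if "C \<subseteq> car B" "s \<in> subtensor B B (car B) C" "z \<in> car B"
      "\<And>q. q \<in> C \<Longrightarrow> mult B (q \<odot> z) \<in> prim_ideal" for s z C
  proof (rule lin_tensor_into[OF is_vspace_tprod lin_\<Psi>[OF that(3)] order_refl that(1) _ _ that(2)])
    fix p q assume "p \<in> car B" "q \<in> C"
    then show "\<Psi> (p \<odot> q) z \<in> T"
      using that(1,3) that(4)[of q]
      by (auto simp: \<Psi>_def T_def tassoc_ptensor[OF vspace] tmap_ptensor[OF lin_id lin_mult]
          subset_iff intro!: ptensor_subtensor)
  qed (use T in simp)
  have \<Phi>: "braid B (mult B (a \<odot> b) \<odot> y) \<in> T"
    if ab: "a \<in> car B" "b \<in> car B" "y \<in> car B" and C: "C \<subseteq> car B"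
      and w: "braid B (b \<odot> y) \<in> subtensor B B (car B) C"
      and pure: "\<And>p q. p \<in> car B \<Longrightarrow> q \<in> C \<Longrightarrow> \<Psi> (braid B (a \<odot> p)) q \<in> T" for a b y C
  proof -
    define F where
      "F w = tmap B B id (mult B) (tassoc B B B (braid_l B (tassoc_inv B B B (ptensor B (B \<otimes> B) a w))))"
      for w
    have "lin (B \<otimes> B) (B \<otimes> B) F"
      unfolding F_def
      by (rule lin_comp[OF lin_comp[OF lin_comp[OF lin_comp[OF lin_ptensor_right[OF ab(1)]
            lin_tassoc_inv[OF vspace]] lin_braid_l] lin_tassoc[OF vspace]] lin_tmap[OF lin_id lin_mult]])
    then have "F (braid B (b \<odot> y)) \<in> T"
    proof (rule lin_tensor_into[OF is_vspace_tprod _ order_refl C _ _ w])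
      fix p q assume "p \<in> car B" "q \<in> C"
      then show "F (p \<odot> q) \<in> T"
        using pure[of p q] C ab
        by (auto simp: F_def \<Psi>_def tassoc_inv_ptensor[OF vspace] braid_l_pure subset_iff)
    qed (use T in simp)
    moreover have "braid B (mult B (a \<odot> b) \<odot> y) = F (braid B (b \<odot> y))"
      using braid_mult_left[of "ptensor (B \<otimes> B) B (a \<odot> b) y"] ab
      by (simp add: F_def ptensor_in tmap_ptensor[OF lin_mult lin_id] braid_r_pure)
    ultimately show ?thesis by simp
  qed
  have "two_sided_ideal B J"
    unfolding two_sided_ideal_def
  proof (intro conjI ballI)
    show "subspace J"
      unfolding J_def
      by (rule lin_preimage_subspace[OF lin_comp[OF lin_ptensor_left lin_braid] T])
    show "J \<subseteq> car B" unfolding J_def by blast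
    fix b z assume b: "b \<in> car B" and z: "z \<in> J"
    then have zc: "z \<in> car B" by (simp add: J_def)
    have "braid B (mult B (b \<odot> z) \<odot> y) \<in> T" if y: "y \<in> car B" for y
    proof (rule \<Phi>[OF b zc y prim_ideal_car])
      show "braid B (z \<odot> y) \<in> subtensor B B (car B) prim_ideal"
        using z y by (simp add: J_def T_def)
      fix p q assume "p \<in> car B" "q \<in> prim_ideal"
      then show "\<Psi> (braid B (b \<odot> p)) q \<in> T"
        using prim_ideal_car prim_ideal_mult(1) braid_in[OF b]
        by (intro \<Psi>[OF order_refl]) (auto simp: subtensor_car)
    qed
    then show "mult B (b \<odot> z) \<in> J" using mult_in[OF b zc] by (simp add: J_def)
    have "braid B (mult B (z \<odot> b) \<odot> y) \<in> T" if y: "y \<in> car B" for y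
    proof (rule \<Phi>[OF zc b y order_refl])
      show "braid B (b \<odot> y) \<in> subtensor B B (car B) (car B)"
        using braid_in[OF b y] by (simp add: subtensor_car)
      fix p q assume "p \<in> car B" "q \<in> car B"
      then show "\<Psi> (braid B (z \<odot> p)) q \<in> T"
        using z prim_ideal_mult(2) by (intro \<Psi>[OF prim_ideal_car]) (auto simp: J_def T_def)
    qed
    then show "mult B (z \<odot> b) \<in> J" using mult_in[OF zc b] by (simp add: J_def)
  qed
  moreover have "E_comp B n \<subseteq> J" if n: "2 \<le> n" for n
  proof
    fix z assume z: "z \<in> E_comp B n"
    have "{z \<in> hcomp B n. reduced_comult z = 0} \<subseteq> prim_ideal"
      using primitive_E_comp E_comp_ideal[OF n] by blast
    moreover have "reduced_comult z = 0" using E_comp_primitive[OF _ z] n by simp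
    ultimately have "braid B (z \<odot> y) \<in> T" if "y \<in> car B" for y
      using braid_primitive_left[of z n y] z that subtensor_mono[OF order_refl]
      unfolding T_def E_comp_def by blast
    then show "z \<in> J" using z E_comp_car by (auto simp: J_def)
  qed
  ultimately have "prim_ideal \<subseteq> J" by (rule prim_ideal_minimal)
  with x y show ?thesis by (auto simp: J_def T_def)
qed

text \<open>The mirror image, by \<open>c (B \<otimes> m) = (m \<otimes> B) (B \<otimes> c) (c \<otimes> B)\<close>.\<close>

lemma braid_prim_ideal_right:
  assumes x: "x \<in> car B" and y: "y \<in> prim_ideal"
  shows "braid B (x \<odot> y) \<in> subtensor B B prim_ideal (car B)"
proof -
  define T where "T = subtensor B B prim_ideal (car B)"
  have T: "tensor.subspace T" unfolding T_def by (rule subtensor_subspace)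
  define J where "J = {y \<in> car B. \<forall>x\<in>car B. braid B (x \<odot> y) \<in> T}"
  \<comment> \<open>\<open>\<Psi>\<close> is \<open>m \<otimes> B\<close>; with the braiding applied first, it is the last part of \<open>c (B \<otimes> m)\<close>\<close>
  define \<Psi> where "\<Psi> z s = tmap B B (mult B) id (tassoc_inv B B B (ptensor B (B \<otimes> B) z s))" for z s
  have lin_\<Psi>: "lin (B \<otimes> B) (B \<otimes> B) (\<Psi> z)" if "z \<in> car B" for z
    unfolding \<Psi>_def
    by (rule lin_comp[OF lin_comp[OF lin_ptensor_right[OF that] lin_tassoc_inv[OF vspace]]
          lin_tmap[OF lin_mult lin_id]])
  have \<Psi>: "\<Psi> z s \<in> T"
    if "C \<subseteq> car B" "s \<in> subtensor B B C (car B)" "z \<in> car B"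
      "\<And>q. q \<in> C \<Longrightarrow> mult B (z \<odot> q) \<in> prim_ideal" for s z C
  proof (rule lin_tensor_into[OF is_vspace_tprod lin_\<Psi>[OF that(3)] that(1) order_refl _ _ that(2)])
    fix q p assume "q \<in> C" "p \<in> car B"
    then show "\<Psi> z (q \<odot> p) \<in> T"
      using that(1,3) that(4)[of q]
      by (auto simp: \<Psi>_def T_def tassoc_inv_ptensor[OF vspace] tmap_ptensor[OF lin_mult lin_id]
          subset_iff intro!: ptensor_subtensor)
  qed (use T in simp)
  have \<Phi>: "braid B (x \<odot> mult B (a \<odot> b)) \<in> T"
    if ab: "a \<in> car B" "b \<in> car B" "x \<in> car B" and C: "C \<subseteq> car B"
      and w: "braid B (x \<odot> a) \<in> subtensor B B C (car B)"
      and pure: "\<And>p q. p \<in> C \<Longrightarrow> q \<in> car B \<Longrightarrow> \<Psi> p (braid B (q \<odot> b)) \<in> T" for a b x C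
  proof -
    define F where "F w = tmap B B (mult B) id (braid_r B (ptensor (B \<otimes> B) B w b))" for w
    have "lin (B \<otimes> B) (B \<otimes> B) F"
      unfolding F_def
      by (rule lin_comp[OF lin_comp[OF lin_ptensor_left[OF ab(2)] lin_braid_r]
            lin_tmap[OF lin_mult lin_id]])
    then have "F (braid B (x \<odot> a)) \<in> T"
    proof (rule lin_tensor_into[OF is_vspace_tprod _ C order_refl _ _ w])
      fix p q assume "p \<in> C" "q \<in> car B"
      then show "F (p \<odot> q) \<in> T"
        using pure[of p q] C ab by (auto simp: F_def \<Psi>_def braid_r_pure subset_iff)
    qed (use T in simp)
    moreover have "braid B (x \<odot> mult B (a \<odot> b)) = F (braid B (x \<odot> a))"
      using braid_mult_right[of "ptensor (B \<otimes> B) B (x \<odot> a) b"] ab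
      by (simp add: F_def ptensor_in tassoc_ptensor[OF vspace] tmap_ptensor[OF lin_id lin_mult]
          braid_l_pure)
    ultimately show ?thesis by simp
  qed
  have "two_sided_ideal B J"
    unfolding two_sided_ideal_def
  proof (intro conjI ballI)
    show "subspace J"
      unfolding J_def
      by (rule lin_preimage_subspace[OF lin_comp[OF lin_ptensor_right lin_braid] T])
    show "J \<subseteq> car B" unfolding J_def by blast
    fix b z assume b: "b \<in> car B" and z: "z \<in> J"
    then have zc: "z \<in> car B" by (simp add: J_def)
    have "braid B (x \<odot> mult B (b \<odot> z)) \<in> T" if x: "x \<in> car B" for x
    proof (rule \<Phi>[OF b zc x order_refl])
      show "braid B (x \<odot> b) \<in> subtensor B B (car B) (car B)"
        using braid_in[OF x b] by (simp add: subtensor_car)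
      fix p q assume "p \<in> car B" "q \<in> car B"
      then show "\<Psi> p (braid B (q \<odot> z)) \<in> T"
        using z prim_ideal_mult(1) by (intro \<Psi>[OF prim_ideal_car]) (auto simp: J_def T_def)
    qed
    then show "mult B (b \<odot> z) \<in> J" using mult_in[OF b zc] by (simp add: J_def)
    have "braid B (x \<odot> mult B (z \<odot> b)) \<in> T" if x: "x \<in> car B" for x
    proof (rule \<Phi>[OF zc b x prim_ideal_car])
      show "braid B (x \<odot> z) \<in> subtensor B B prim_ideal (car B)"
        using z x by (simp add: J_def T_def)
      fix p q assume "p \<in> prim_ideal" "q \<in> car B"
      then show "\<Psi> p (braid B (q \<odot> b)) \<in> T"
        using prim_ideal_car prim_ideal_mult(2) braid_in[OF _ b]
        by (intro \<Psi>[OF order_refl]) (auto simp: subtensor_car)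
    qed
    then show "mult B (z \<odot> b) \<in> J" using mult_in[OF zc b] by (simp add: J_def)
  qed
  moreover have "E_comp B n \<subseteq> J" if n: "2 \<le> n" for n
  proof
    fix z assume z: "z \<in> E_comp B n"
    have "{z \<in> hcomp B n. reduced_comult z = 0} \<subseteq> prim_ideal"
      using primitive_E_comp E_comp_ideal[OF n] by blast
    moreover have "reduced_comult z = 0" using E_comp_primitive[OF _ z] n by simp
    ultimately have "braid B (x \<odot> z) \<in> T" if "x \<in> car B" for x
      using braid_primitive_right[of x z n] z that subtensor_mono[OF _ order_refl]
      unfolding T_def E_comp_def by blast
    then show "z \<in> J" using z E_comp_car by (auto simp: J_def)
  qed
  ultimately have "prim_ideal \<subseteq> J" by (rule prim_ideal_minimal)
  with x y show ?thesis by (auto simp: J_def T_def)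
qed


subsection \<open>The symmetric algebra as a quotient\<close>

abbreviation proj :: "'a \<Rightarrow> 'a" where
  "proj \<equiv> sym_proj B"

abbreviation quot :: "('k, 'a) vspace" where
  "quot \<equiv> \<lparr>scl = scl B, car = proj ` car B\<rparr>"

lemma quot_map_proj: "is_quot_map B prim_ideal proj"
  unfolding sym_proj_def by (rule quot_map_exists[OF vspace prim_ideal_subspace prim_ideal_car])

lemma lin_proj: "lin B B proj" and proj_idem: "x \<in> car B \<Longrightarrow> proj (proj x) = proj x"
  and proj_kernel: "x \<in> car B \<Longrightarrow> proj x = 0 \<longleftrightarrow> x \<in> prim_ideal"
  using quot_map_proj by (auto simp: is_quot_map_def)

lemma proj_in: "x \<in> car B \<Longrightarrow> proj x \<in> car B"
  by (rule lin_in[OF lin_proj])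

lemma proj_diff: "x \<in> car B \<Longrightarrow> x - proj x \<in> prim_ideal"
  using lin_diff[OF vspace lin_proj _ proj_in, of x x] vspace_diff[OF vspace _ proj_in, of x x]
    proj_idem proj_kernel by simp

lemma vspace_quot: "is_vspace quot"
  using lin_image_subspace[OF lin_proj vspace vspace vspace_subspace[OF vspace] order_refl] vspace
  by (simp add: is_vspace_def)

lemma lin_proj_quot: "lin B quot proj"
  using lin_proj by (auto simp: lin_def)

lemma sym_alg_simps:
  "car (sym_alg B) = proj ` car B"
  "hcomp (sym_alg B) n = proj ` hcomp B n"
  "mult (sym_alg B) = proj \<circ> mult B \<circ> tmap B B id id"
  "braid (sym_alg B) = tmap quot quot proj proj \<circ> braid B \<circ> tmap B B id id"
  by (simp_all add: sym_alg_def Let_def)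

lemma ptensor_sym_alg: "ptensor (sym_alg B) (sym_alg B) = ptensor quot quot"
  by (intro ext) (simp add: ptensor_def bilin_def lin_def sym_alg_def Let_def)

lemma lift_proj: "tmap B B id id (tmap quot quot proj proj r) = tmap B B proj proj r"
proof -
  have "bilin quot quot ground \<beta>" if "bilin B B ground \<beta>" for \<beta>
    using that proj_in by (auto simp: bilin_def lin_def)
  then show ?thesis by (auto simp: tmap_def fun_eq_iff)
qed

text \<open>
  The representative \<open>proj x\<close> differs from \<open>x\<close> by an element of the ideal, which need not be
  homogeneous. Structure maps can be evaluated on representatives because they send the first
  two summands to elements that vanish in the quotient.
\<close>

lemma tens_decompose:
  assumes "x \<in> car B" "y \<in> car B"
  shows "x \<odot> y = (x - proj x) \<odot> y + proj x \<odot> (y - proj y) + proj x \<odot> proj y"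
  using assms lin_diff[OF vspace lin_ptensor_left[OF assms(2)] assms(1) proj_in[OF assms(1)]]
    lin_diff[OF vspace lin_ptensor_right[OF proj_in[OF assms(1)]] assms(2) proj_in[OF assms(2)]]
  by simp

lemma mult_sym_alg_proj:
  assumes r: "r \<in> car (B \<otimes> B)"
  shows "mult (sym_alg B) (tmap quot quot proj proj r) = proj (mult B r)"
proof -
  have "proj (mult B (tmap B B proj proj r)) = proj (mult B r)"
  proof (rule lin_tensor_eqI[where F = "\<lambda>r. proj (mult B (tmap B B proj proj r))"
        and G = "\<lambda>r. proj (mult B r)", OF vspace _ _ _ r])
    show "lin (B \<otimes> B) B (\<lambda>r. proj (mult B (tmap B B proj proj r)))"
      by (rule lin_comp[OF lin_comp[OF lin_tmap[OF lin_proj lin_proj] lin_mult] lin_proj])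
    show "lin (B \<otimes> B) B (\<lambda>r. proj (mult B r))" by (rule lin_comp[OF lin_mult lin_proj])
    fix x y assume x: "x \<in> car B" and y: "y \<in> car B"
    let ?u = "mult B ((x - proj x) \<odot> y)" and ?v = "mult B (proj x \<odot> (y - proj y))"
    have dc: "x - proj x \<in> car B" "y - proj y \<in> car B"
      using vspace_diff[OF vspace _ proj_in] x y by simp_all
    have uv: "?u \<in> prim_ideal" "?v \<in> prim_ideal"
      using x y by (simp_all add: prim_ideal_mult proj_diff proj_in)
    have "mult B (x \<odot> y) = ?u + ?v + mult B (proj x \<odot> proj y)"
      by (subst tens_decompose[OF x y])
         (simp add: lin_add[OF lin_mult] vspace_closed(1)[OF is_vspace_tprod] x y dc proj_in)
    moreover have "proj (?u + ?v) = 0"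
      using subspace_add[OF prim_ideal_subspace uv] prim_ideal_car proj_kernel by blast
    ultimately have "proj (mult B (x \<odot> y)) = proj (mult B (proj x \<odot> proj y))"
      using lin_add[OF lin_proj vspace_closed(1)[OF vspace], of ?u ?v "mult B (proj x \<odot> proj y)"]
      by (simp add: mult_in dc x y proj_in)
    then show "proj (mult B (tmap B B proj proj (x \<odot> y))) = proj (mult B (x \<odot> y))"
      by (simp add: tmap_ptensor[OF lin_proj lin_proj x y])
  qed
  then show ?thesis by (simp add: sym_alg_simps lift_proj)
qed

lemma braid_sym_alg_proj:
  assumes r: "r \<in> car (B \<otimes> B)"
  shows "braid (sym_alg B) (tmap quot quot proj proj r) = tmap quot quot proj proj (braid B r)"
proof -
  let ?P = "tmap quot quot proj proj"
  note lin_P = lin_tmap[OF lin_proj_quot lin_proj_quot]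
  have proj_0: "proj i = 0" if "i \<in> prim_ideal" for i
    using that prim_ideal_car proj_kernel by blast
  have P_left: "?P w = 0" if "w \<in> subtensor B B (car B) prim_ideal" for w
  proof -
    have "?P w \<in> {0}"
    proof (rule lin_tensor_into[OF is_vspace_tprod lin_P order_refl prim_ideal_car _ _ that])
      fix a i assume a: "a \<in> car B" and i: "i \<in> prim_ideal"
      have "ptensor quot quot (proj a) 0 = 0"
        using a by (intro lin_zero[OF vspace_quot lin_ptensor_right]) simp
      then show "?P (a \<odot> i) \<in> {0}"
        using a i prim_ideal_car by (auto simp: tmap_ptensor[OF lin_proj_quot lin_proj_quot] proj_0)
    qed simp
    then show ?thesis by simp
  qed
  have P_right: "?P w = 0" if "w \<in> subtensor B B prim_ideal (car B)" for w
  proof -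
    have "?P w \<in> {0}"
    proof (rule lin_tensor_into[OF is_vspace_tprod lin_P prim_ideal_car order_refl _ _ that])
      fix a i assume a: "a \<in> car B" and i: "i \<in> prim_ideal"
      have "ptensor quot quot 0 (proj a) = 0"
        using a by (intro lin_zero[OF vspace_quot lin_ptensor_left]) simp
      then show "?P (i \<odot> a) \<in> {0}"
        using a i prim_ideal_car by (auto simp: tmap_ptensor[OF lin_proj_quot lin_proj_quot] proj_0)
    qed simp
    then show ?thesis by simp
  qed
  have "?P (braid B (tmap B B proj proj r)) = ?P (braid B r)"
  proof (rule lin_tensor_eqI[where F = "\<lambda>r. ?P (braid B (tmap B B proj proj r))"
        and G = "\<lambda>r. ?P (braid B r)", OF is_vspace_tprod _ _ _ r])
    show "lin (B \<otimes> B) (quot \<otimes> quot) (\<lambda>r. ?P (braid B (tmap B B proj proj r)))"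
      by (rule lin_comp[OF lin_comp[OF lin_tmap[OF lin_proj lin_proj] lin_braid] lin_P])
    show "lin (B \<otimes> B) (quot \<otimes> quot) (\<lambda>r. ?P (braid B r))" by (rule lin_comp[OF lin_braid lin_P])
    fix x y assume x: "x \<in> car B" and y: "y \<in> car B"
    have dc: "x - proj x \<in> car B" "y - proj y \<in> car B"
      using vspace_diff[OF vspace _ proj_in] x y by simp_all
    have "braid B (x \<odot> y) = braid B ((x - proj x) \<odot> y) + braid B (proj x \<odot> (y - proj y))
        + braid B (proj x \<odot> proj y)"
      by (subst tens_decompose[OF x y])
         (simp add: lin_add[OF lin_braid] vspace_closed(1)[OF is_vspace_tprod] x y dc proj_in)
    then have "?P (braid B (x \<odot> y)) = ?P (braid B (proj x \<odot> proj y))"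
      by (simp add: tmap_add x y proj_in P_left[OF braid_prim_ideal_left] proj_diff
          P_right[OF braid_prim_ideal_right])
    then show "?P (braid B (tmap B B proj proj (x \<odot> y))) = ?P (braid B (x \<odot> y))"
      by (simp add: tmap_ptensor[OF lin_proj lin_proj x y])
  qed
  then show ?thesis by (simp add: sym_alg_simps lift_proj)
qed

lemma hcomp2_sym_alg:
  "hcomp2 (sym_alg B) a b \<subseteq> tmap quot quot proj proj ` hcomp2 B a b"
proof -
  note lin_P = lin_tmap[OF lin_proj_quot lin_proj_quot]
  have "tensor.subspace (tmap quot quot proj proj ` hcomp2 B a b)"
    using lin_image_subspace[OF lin_P is_vspace_tprod is_vspace_tprod _ hcomp2_car]
    by (simp add: hcomp2_def subtensor_subspace)
  then show ?thesis
    unfolding hcomp2_def[of "sym_alg B"] subtensor_def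
  proof (rule tensor.span_minimal[rotated], intro subsetI)
    fix t assume "t \<in> {ptensor (sym_alg B) (sym_alg B) x y |x y.
      x \<in> hcomp (sym_alg B) a \<and> y \<in> hcomp (sym_alg B) b}"
    then obtain x y where xy: "x \<in> hcomp B a" "y \<in> hcomp B b" "t = ptensor quot quot (proj x) (proj y)"
      by (auto simp: sym_alg_simps ptensor_sym_alg)
    then have "t = tmap quot quot proj proj (x \<odot> y)"
      by (simp add: tmap_ptensor[OF lin_proj_quot lin_proj_quot hcomp_in hcomp_in])
    then show "t \<in> tmap quot quot proj proj ` hcomp2 B a b"
      using tens_hcomp2[OF xy(1,2)] by blast
  qed
qed

lemma poly_endo_sym_alg:
  assumes r: "r \<in> car (B \<otimes> B)"
  shows "poly_endo tscl g (braid (sym_alg B)) (tmap quot quot proj proj r)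
    = tmap quot quot proj proj (poly_endo tscl g (braid B) r)"
proof -
  have "(braid B ^^ i) r \<in> car (B \<otimes> B) \<and>
      (braid (sym_alg B) ^^ i) (tmap quot quot proj proj r) = tmap quot quot proj proj ((braid B ^^ i) r)"
    for i
    by (induction i) (simp_all add: r lin_in[OF lin_braid] braid_sym_alg_proj)
  then show ?thesis by (simp only: poly_endo_def tmap_sum tmap_scale)
qed

end


section \<open>Polynomials of an endomorphism\<close>

lemma funpow_in: "lin V V T \<Longrightarrow> x \<in> car V \<Longrightarrow> (T ^^ i) x \<in> car V"
  by (induction i) (auto simp: lin_def)

lemma poly_endo_in:
  assumes V: "is_vspace V" and T: "lin V V T" and x: "x \<in> car V"
  shows "poly_endo (scl V) g T x \<in> car V"
proof -
  interpret V: module "scl V" by (rule vspace_module[OF V])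
  show ?thesis
    unfolding poly_endo_def using funpow_in[OF T x] vspace_closed(2)[OF V]
    by (intro V.subspace_sum[OF vspace_subspace[OF V]]) simp
qed

lemma poly_endo_upper:
  assumes V: "is_vspace V" and "degree g \<le> n"
  shows "poly_endo (scl V) g T x = (\<Sum>i\<le>n. scl V (coeff g i) ((T ^^ i) x))"
proof -
  interpret V: module "scl V" by (rule vspace_module[OF V])
  show ?thesis
    unfolding poly_endo_def using assms(2)
    by (intro sum.mono_neutral_left) (auto simp: coeff_eq_0)
qed

lemma poly_endo_one_plus_X:
  assumes V: "is_vspace V" and T: "lin V V T" and x: "x \<in> car V"
  shows "poly_endo (scl V) ([:1, 1:] * h) T x = poly_endo (scl V) h T x + T (poly_endo (scl V) h T x)"
proof -
  interpret V: module "scl V" by (rule vspace_module[OF V])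
  let ?n = "degree h"
  have f: "[:1, 1:] * h = h + pCons 0 h" by simp
  have "degree (pCons 0 h) \<le> Suc ?n" by (rule degree_pCons_le)
  then have deg: "degree ([:1, 1:] * h) \<le> Suc ?n"
    unfolding f by (intro degree_add_le) simp_all
  have "poly_endo (scl V) ([:1, 1:] * h) T x
      = (\<Sum>i\<le>Suc ?n. scl V (coeff h i) ((T ^^ i) x))
        + (\<Sum>i\<le>Suc ?n. scl V (coeff (pCons 0 h) i) ((T ^^ i) x))"
    unfolding poly_endo_upper[OF V deg]
    by (simp only: f coeff_add V.scale_left_distrib sum.distrib)
  also have "(\<Sum>i\<le>Suc ?n. scl V (coeff h i) ((T ^^ i) x)) = poly_endo (scl V) h T x"
    by (rule poly_endo_upper[OF V, symmetric]) simp
  also have "(\<Sum>i\<le>Suc ?n. scl V (coeff (pCons 0 h) i) ((T ^^ i) x))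
      = (\<Sum>i\<le>?n. scl V (coeff h i) (T ((T ^^ i) x)))"
    by (simp only: sum.atMost_Suc_shift coeff_pCons_0 coeff_pCons_Suc V.scale_zero_left funpow.simps
        comp_apply) simp
  also have "\<dots> = T (poly_endo (scl V) h T x)"
    unfolding poly_endo_def
    using funpow_in[OF T x] vspace_closed(2)[OF V]
    by (subst lin_sum[OF V T]) (simp_all add: lin_scale[OF T])
  finally show ?thesis .
qed


section \<open>The strongness degree\<close>

lemma sym_stable_Suc: "sym_stable B (Suc t) \<longleftrightarrow> sym_stable (sym_alg B) t"
  by (simp only: sym_stable_def sym_iter_def funpow_Suc_right comp_apply)

lemma sdeg_Suc:
  assumes "\<not> sym_stable B 0"
  shows "sdeg B = sdeg (sym_alg B) + 1"
proof (cases "\<exists>t. sym_stable B t")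
  case True
  then obtain t where t: "sym_stable B t" by blast
  then obtain t' where "t = Suc t'" using assms by (cases t) auto
  then have "\<exists>t. sym_stable (sym_alg B) t" using t sym_stable_Suc by blast
  moreover have "(LEAST t. sym_stable B t) = Suc (LEAST t. sym_stable (sym_alg B) t)"
    using Least_Suc[of "sym_stable B", OF t assms] by (simp add: sym_stable_Suc)
  ultimately show ?thesis using True by (simp add: sdeg_def one_enat_def)
next
  case False
  then have "\<not> (\<exists>t. sym_stable (sym_alg B) t)" using sym_stable_Suc by blast
  with False show ?thesis by (simp add: sdeg_def)
qed

theorem theorem4p13:
  fixes B :: "('k::field, 'a::ab_group_add) bialg" and f h :: "'k poly"
  assumes "graded_braided_bialgebra B" and "zero_connected B"
    and "bij_betw (mult B) (hcomp2 B 1 1) (hcomp B 2)"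
    and "is_min_poly tscl (hcomp2 B 1 1) (braid B) f"
    and "poly f (- 1) = 0" and "f = [:1, 1:] * h"
  shows "sdeg B = sdeg (sym_alg B) + 1
    \<and> (\<forall>t\<in>hcomp2 (sym_alg B) 1 1. mult (sym_alg B) (poly_endo tscl h (braid (sym_alg B)) t) = 0)"
proof -
  interpret connected_braided_bialg B
    by unfold_locales (fact assms(1), fact assms(2))
  define V where "V = \<lparr>scl = tscl, car = hcomp2 B 1 1\<rparr>"
  have V: "is_vspace V"
    by (simp add: V_def is_vspace_def vector_space_tscl hcomp2_def subtensor_subspace)
  have T: "lin V V (braid B)"
    using lin_braid hcomp2_car braid_hcomp unfolding V_def lin_def by (simp add: subset_iff)
  have hV: "poly_endo tscl h (braid B) t \<in> hcomp2 B 1 1" if "t \<in> hcomp2 B 1 1" for t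
    using poly_endo_in[OF V T, of t h] that by (simp add: V_def)
  \<comment> \<open>\<open>f c = (1 + c) (h c)\<close> vanishes, so \<open>c\<close> acts as \<open>- 1\<close> on the image of \<open>h c\<close>\<close>
  have root: "poly_endo tscl h (braid B) t + braid B (poly_endo tscl h (braid B) t) = 0"
    if "t \<in> hcomp2 B 1 1" for t
    using poly_endo_one_plus_X[OF V T, of t h] that assms(4)
    by (simp add: V_def is_min_poly_def annihilates_def assms(6))
  have prim: "mult B (poly_endo tscl h (braid B) t) \<in> prim_ideal" if "t \<in> hcomp2 B 1 1" for t
  proof -
    have "reduced_comult (mult B (poly_endo tscl h (braid B) t)) = 0"
      using reduced_comult_mult_hcomp2[OF hV[OF that]] root[OF that] by simp
    moreover have "mult B (poly_endo tscl h (braid B) t) \<in> hcomp B 2"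
      using mult_hcomp[OF hV[OF that]] by (simp only: one_add_one)
    ultimately show ?thesis using primitive_E_comp E_comp_ideal[of 2] by blast
  qed
  have "\<not> sym_stable B 0"
  proof
    assume "sym_stable B 0"
    then have inj: "inj_on proj (car B)"
      by (simp add: sym_stable_def sym_iter_def bij_betw_def)
    \<comment> \<open>by minimality of \<open>f\<close> the image of \<open>h c\<close> is not zero, and \<open>m\<close> embeds it into the kernel\<close>
    have f0: "f \<noteq> 0" using assms(4) by (auto simp: is_min_poly_def)
    then have h0: "h \<noteq> 0" using assms(6) by auto
    have "degree f = Suc (degree h)"
      using h0 unfolding assms(6) by (subst degree_mult_eq) auto
    then have "\<not> annihilates tscl (hcomp2 B 1 1) (braid B) h"
      using assms(4) h0 unfolding is_min_poly_def by (metis not_less_eq_eq order_refl)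
    then obtain t where t: "t \<in> hcomp2 B 1 1" "poly_endo tscl h (braid B) t \<noteq> 0"
      by (auto simp: annihilates_def)
    let ?y = "mult B (poly_endo tscl h (braid B) t)"
    have "proj ?y = proj 0"
      using prim[OF t(1)] prim_ideal_car proj_kernel[of ?y] lin_zero[OF vspace lin_proj] by auto
    then have "?y = 0"
      using inj prim[OF t(1)] prim_ideal_car vspace_0[OF vspace] by (meson inj_onD subsetD)
    then have "mult B (poly_endo tscl h (braid B) t) = mult B 0"
      using lin_zero[OF is_vspace_tprod lin_mult] by simp
    moreover have "0 \<in> hcomp2 B 1 1"
      unfolding hcomp2_def by (rule tensor.subspace_0[OF subtensor_subspace])
    ultimately have "poly_endo tscl h (braid B) t = 0"
      using assms(3) hV[OF t(1)] unfolding bij_betw_def by (meson inj_onD)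
    with t(2) show False ..
  qed
  moreover have "mult (sym_alg B) (poly_endo tscl h (braid (sym_alg B)) t) = 0"
    if t: "t \<in> hcomp2 (sym_alg B) 1 1" for t
  proof -
    obtain r where r: "r \<in> hcomp2 B 1 1" "t = tmap quot quot proj proj r"
      using t hcomp2_sym_alg by blast
    have "mult (sym_alg B) (poly_endo tscl h (braid (sym_alg B)) t)
        = proj (mult B (poly_endo tscl h (braid B) r))"
      using r hcomp2_car hV[OF r(1)]
      by (simp add: poly_endo_sym_alg mult_sym_alg_proj subset_iff)
    also have "\<dots> = 0" using prim[OF r(1)] prim_ideal_car proj_kernel by blast
    finally show ?thesis .
  qed
  ultimately show ?thesis using sdeg_Suc by blast
qed

end
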